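(* Let $\emptyset\ne\mathcal{H}\subset\mathcal{F}(T)$ be a covering family, let $x^*\in X^*$, and consider the following statements: (i) $\mathcal{H}$-strong duality holds at $x^*$, i.e. $$(f+\delta_E)^*(x^* )=\min_{H\in\mathcal{H},\ \mu\in\mathbb{R}_+^H}\left(f+\sum_{t\in H}\mu_tf_t\right)^*(x^* ).$$ (ii) $\mathcal{A}_{\mathcal{H}}$ is $w^*$-closed convex regarding $\{x^*\}\times\mathbb{R}$. Then (i) $\Rightarrow$ (ii). If, moreover, $\{f;\,f_t,t\in T\}\subset\Gamma(X)$ and $E\cap\operatorname{dom}f\neq\emptyset$, then (i) $\Leftrightarrow$ (ii). In particular (under these additional assumptions), $\mathcal{H}$-stable strong duality holds if and only if $\mathcal{A}_{\mathcal{H}}$ is $w^*$-closed convex.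
   Context: $X$ is a locally convex Hausdorff (real) topological vector space; its topological dual $X^*$ carries the weak*-topology and $X^*\times\mathbb{R}$ the product topology. $T$ is an infinite index set, $f$ and $f_t$ ($t\in T$) are convex proper functions $X\to\mathbb{R}\cup\{+\infty\}$, and $\mathcal{F}(T)$ is the family of all non-empty finite subsets of $T$. The convention $0\times(+\infty)=0$ is used. $\Gamma(X)$ is the class of lower semicontinuous proper convex functions on $X$. $E:=\{x\in X: f_t(x)\le 0\ \forall t\in T\}$, and $\delta_E$ is its indicator function ($0$ on $E$, $+\infty$ elsewhere). For $h:X\to\overline{\mathbb{R}}$, $h^*(x^* )=\sup_{x\in X}\{\langle x^*,x\rangle-h(x)\}$ and $\operatorname{epi}h^*=\{(x^*,r)\in X^*\times\mathbb{R}:h^*(x^* )\le r\}$. $\mathcal{A}_{\mathcal{H}}:=\bigcup_{H\in\mathcal{H}}\bigcup_{\mu\in\mathbb{R}_+^H}\operatorname{epi}\left(f+\sum_{t\in H}\mu_tf_t\right)^*\subset X^*\times\mathbb{R}$. $\mathcal{H}$ is covering if $\bigcup_{H\in\mathcal{H}}H=T$. The symbol $\min$ means that the infimum (in $\overline{\mathbb{R}}$) is attained. $\mathcal{H}$-stable strong duality means that $\mathcal{H}$-strong duality holds at every $x^*\in X^*$. A set $\mathbb{A}\subset X^*\times\mathbb{R}$ is $w^*$-closed convex regarding $\mathbb{B}\subset X^*\times\mathbb{R}$ if $(\overline{\operatorname{co}}\,\mathbb{A})\cap\mathbb{B}=\mathbb{A}\cap\mathbb{B}$, where $\overline{\operatorname{co}}$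 denotes the closed convex hull in $X^*\times\mathbb{R}$. *)

theory Defs
  imports "HOL-Analysis.Analysis"
begin

section \<open>Locally convex Hausdorff spaces and the weak* topology\<close>

class topological_real_vector = real_vector + topological_ab_group_add +
  assumes tendsto_scaleR_nhds:
    "((\<lambda>p. fst p *\<^sub>R snd p) \<longlongrightarrow> c *\<^sub>R x) (nhds c \<times>\<^sub>F nhds x)"

class locally_convex_space = topological_real_vector + t2_space +
  assumes locally_convex_at_0:
    "open U \<Longrightarrow> 0 \<in> U \<Longrightarrow> \<exists>V. open V \<and> 0 \<in> V \<and> V \<subseteq> U \<and>
       (\<forall>x\<in>V. \<forall>y\<in>V. \<forall>u\<ge>0. \<forall>v\<ge>0. u + v = 1 \<longrightarrow> u *\<^sub>R x + v *\<^sub>R y \<in> V)"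

lemma locally_convex_at_0_convex:
  fixes U :: "'a::locally_convex_space set"
  assumes "open U" and "0 \<in> U"
  shows "\<exists>V. open V \<and> convex V \<and> 0 \<in> V \<and> V \<subseteq> U"
  using locally_convex_at_0[OF assms] unfolding convex_def by blast

typedef (overloaded) ('a::locally_convex_space) dual =
    "{\<phi> :: 'a \<Rightarrow> real. linear \<phi> \<and> continuous_on UNIV \<phi>}"
  morphisms dual_apply Abs_dual
proof
  show "(\<lambda>_. 0) \<in> {\<phi> :: 'a \<Rightarrow> real. linear \<phi> \<and> continuous_on UNIV \<phi>}"
    by (simp add: linear_iff)
qed

setup_lifting type_definition_dual

instantiation dual :: (locally_convex_space) real_vector
begin

lift_definition zero_dual :: "'a dual" is "\<lambda>_. 0"
  by (simp add: linear_iff)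

lift_definition plus_dual :: "'a dual \<Rightarrow> 'a dual \<Rightarrow> 'a dual" is "\<lambda>\<phi> \<psi> x. \<phi> x + \<psi> x"
  by (auto simp: linear_iff algebra_simps intro!: continuous_intros)

lift_definition uminus_dual :: "'a dual \<Rightarrow> 'a dual" is "\<lambda>\<phi> x. - \<phi> x"
  by (auto simp: linear_iff intro!: continuous_intros)

lift_definition minus_dual :: "'a dual \<Rightarrow> 'a dual \<Rightarrow> 'a dual" is "\<lambda>\<phi> \<psi> x. \<phi> x - \<psi> x"
  by (auto simp: linear_iff algebra_simps intro!: continuous_intros)

lift_definition scaleR_dual :: "real \<Rightarrow> 'a dual \<Rightarrow> 'a dual" is "\<lambda>c \<phi> x. c * \<phi> x"
  by (auto simp: linear_iff algebra_simps intro!: continuous_intros)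

instance
  by standard (transfer; simp add: fun_eq_iff algebra_simps)+

end

text \<open>The weak* topology: the topology of pointwise convergence, induced by the product
  topology on \<open>'a \<Rightarrow> real\<close>.\<close>

instantiation dual :: (locally_convex_space) topological_space
begin

definition open_dual :: "'a dual set \<Rightarrow> bool" where
  "open_dual U \<longleftrightarrow> openin (pullback_topology UNIV dual_apply euclidean) U"

instance
proof
  show "open (UNIV :: 'a dual set)"
    unfolding open_dual_def openin_pullback_topology by (intro exI[of _ UNIV]) auto
qed (auto simp: open_dual_def)

end


section \<open>Extended-real-valued convex functions\<close>

definition epigraph :: "('b \<Rightarrow> ereal) \<Rightarrow> ('b \<times> real) set" where
  "epigraph h = {(x, r). h x \<le> ereal r}"

definition domain :: "('b \<Rightarrow> ereal) \<Rightarrow> 'b set" where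
  "domain h = {x. h x < \<infinity>}"

definition proper_fun :: "('b \<Rightarrow> ereal) \<Rightarrow> bool" where
  "proper_fun h \<longleftrightarrow> (\<forall>x. h x \<noteq> -\<infinity>) \<and> domain h \<noteq> {}"

definition convex_fun :: "('b::real_vector \<Rightarrow> ereal) \<Rightarrow> bool" where
  "convex_fun h \<longleftrightarrow> convex (epigraph h)"

definition lsc_fun :: "('b::topological_space \<Rightarrow> ereal) \<Rightarrow> bool" where
  "lsc_fun h \<longleftrightarrow> (\<forall>x c. c < h x \<longrightarrow> (\<forall>\<^sub>F y in nhds x. c < h y))"

definition lsc_proper_convex :: "('a::locally_convex_space \<Rightarrow> ereal) set" where
  "lsc_proper_convex = {h. lsc_fun h \<and> proper_fun h \<and> convex_fun h}"

definition indicator_fun :: "'b set \<Rightarrow> 'b \<Rightarrow> ereal" where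
  "indicator_fun S x = (if x \<in> S then 0 else \<infinity>)"

definition conjugate :: "('a::locally_convex_space \<Rightarrow> ereal) \<Rightarrow> 'a dual \<Rightarrow> ereal" where
  "conjugate h \<phi> = (SUP x. ereal (dual_apply \<phi> x) - h x)"

definition closed_convex_regarding :: "('b::{real_vector, topological_space}) set \<Rightarrow> 'b set \<Rightarrow> bool" where
  "closed_convex_regarding A B \<longleftrightarrow> closure (convex hull A) \<inter> B = A \<inter> B"


section \<open>The constraint system and its duality\<close>

definition finite_nonempty_subsets :: "'t set \<Rightarrow> 't set set" where
  "finite_nonempty_subsets T = {H. H \<subseteq> T \<and> finite H \<and> H \<noteq> {}}"

definition feasible_set :: "'t set \<Rightarrow> ('t \<Rightarrow> 'b \<Rightarrow> ereal) \<Rightarrow> 'b set" where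
  "feasible_set T g = {x. \<forall>t\<in>T. g t x \<le> 0}"

text \<open>On \<^typ>\<open>ereal\<close>, \<open>0 * \<infinity> = 0\<close>, so indices with zero multiplier contribute nothing.\<close>

definition lagrangian ::
    "('b \<Rightarrow> ereal) \<Rightarrow> ('t \<Rightarrow> 'b \<Rightarrow> ereal) \<Rightarrow> 't set \<Rightarrow> ('t \<Rightarrow> real) \<Rightarrow> 'b \<Rightarrow> ereal" where
  "lagrangian f g H \<mu> x = f x + (\<Sum>t\<in>H. ereal (\<mu> t) * g t x)"

definition A_set :: "('a::locally_convex_space \<Rightarrow> ereal) \<Rightarrow> ('t \<Rightarrow> 'a \<Rightarrow> ereal)
    \<Rightarrow> 't set set \<Rightarrow> ('a dual \<times> real) set" where
  "A_set f g \<H> = (\<Union>H\<in>\<H>. \<Union>\<mu> \<in> H \<rightarrow>\<^sub>E {0..}. epigraph (conjugate (lagrangian f g H \<mu>)))"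

definition dual_values :: "('a::locally_convex_space \<Rightarrow> ereal) \<Rightarrow> ('t \<Rightarrow> 'a \<Rightarrow> ereal)
    \<Rightarrow> 't set set \<Rightarrow> 'a dual \<Rightarrow> ereal set" where
  "dual_values f g \<H> \<phi> = {conjugate (lagrangian f g H \<mu>) \<phi> | H \<mu>. H \<in> \<H> \<and> \<mu> \<in> H \<rightarrow>\<^sub>E {0..}}"

definition strong_duality_at :: "'t set \<Rightarrow> ('a::locally_convex_space \<Rightarrow> ereal)
    \<Rightarrow> ('t \<Rightarrow> 'a \<Rightarrow> ereal) \<Rightarrow> 't set set \<Rightarrow> 'a dual \<Rightarrow> bool" where
  "strong_duality_at T f g \<H> \<phi> \<longleftrightarrow>
     conjugate (\<lambda>x. f x + indicator_fun (feasible_set T g) x) \<phi> = Inf (dual_values f g \<H> \<phi>) \<and>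
     Inf (dual_values f g \<H> \<phi>) \<in> dual_values f g \<H> \<phi>"

definition stable_strong_duality :: "'t set \<Rightarrow> ('a::locally_convex_space \<Rightarrow> ereal)
    \<Rightarrow> ('t \<Rightarrow> 'a \<Rightarrow> ereal) \<Rightarrow> 't set set \<Rightarrow> bool" where
  "stable_strong_duality T f g \<H> \<longleftrightarrow> (\<forall>\<phi>. strong_duality_at T f g \<H> \<phi>)"

end

theory Submission
  imports Defs
begin

text \<open>
  Write \<open>h = f + \<delta>\<^sub>E\<close> for the constrained objective and \<open>A\<close> for the set \<open>A_set f g \<H>\<close>, the union
  of the epigraphs of the conjugates of the Lagrangians. On the feasible set a Lagrangian is at most
  \<open>f\<close>, so every Lagrangian lies below \<open>h\<close> and \<open>A\<close> lies in the epigraph of \<open>h*\<close>. That epigraph is closed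
  and convex, so it also contains the closed convex hull of \<open>A\<close>. Strong duality at \<open>\<phi>\<close> means, apart from
  the value \<open>- \<infinity>\<close>, that the epigraph of \<open>h*\<close> and \<open>A\<close> have the same fibre over \<open>\<phi>\<close>
  (\<open>strong_duality_attained\<close>, \<open>strong_duality_if_attained\<close>). The hull being squeezed between
  the two, strong duality makes \<open>A\<close> closed convex regarding that fibre.

  The converse holds because the hull fills the epigraph of \<open>h*\<close> (\<open>closure_hull_A_set\<close>).
  Because the family covers \<open>T\<close>, the function \<open>h\<close> is the supremum of the Lagrangians
  (\<open>SUP_lagrangians\<close>), and for a family of lower semicontinuous proper convex functions whose supremum
  is finite somewhere, the epigraph of the conjugate of the supremum is the closed convex hull of
  the epigraphs of the conjugates (\<open>conjugate_Sup\<close>). This rests on the Fenchel--Moreau theorem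
  (\<open>fenchel_moreau\<close>) and on separation in \<open>X* \<times> \<real>\<close>, where weak* continuous functionals are evaluations
  at points of \<open>X\<close> (\<open>separation_weak_star\<close>).

  Both separation theorems specialise one algebraic statement (\<open>separation_algebraic\<close>), derived from
  a Hahn--Banach theorem in which a minimal sublinear function is shown to be linear
  (\<open>hahn_banach_point\<close>).
\<close>

section \<open>Linear minorants of sublinear functions\<close>

definition sublinear :: "('v::real_vector \<Rightarrow> real) \<Rightarrow> bool" where
  "sublinear p \<longleftrightarrow> (\<forall>x y. p (x + y) \<le> p x + p y) \<and> (\<forall>c x. 0 \<le> c \<longrightarrow> p (c *\<^sub>R x) = c * p x)"

lemma sublinearI:
  assumes add: "\<And>x y. p (x + y) \<le> p x + p y"
    and zero: "p 0 = 0"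
    and scale: "\<And>c x. 0 < c \<Longrightarrow> p (c *\<^sub>R x) \<le> c * p x"
  shows "sublinear p"
proof -
  have "p (c *\<^sub>R x) = c * p x" if "0 \<le> c" for c x
  proof (cases "c = 0")
    case True
    then show ?thesis using zero by simp
  next
    case False
    with that have c: "0 < c" by simp
    have "p x \<le> inverse c * p (c *\<^sub>R x)"
      using scale[of "inverse c" "c *\<^sub>R x"] c by simp
    then have "c * p x \<le> p (c *\<^sub>R x)" using c by (simp add: field_simps)
    with scale[OF c] show ?thesis by (intro antisym)
  qed
  with add show ?thesis by (simp add: sublinear_def)
qed

lemma sublinear_add: "sublinear p \<Longrightarrow> p (x + y) \<le> p x + p y"
  and sublinear_scale: "sublinear p \<Longrightarrow> 0 \<le> c \<Longrightarrow> p (c *\<^sub>R x) = c * p x"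
  by (auto simp: sublinear_def)

lemma sublinear_zero: "sublinear p \<Longrightarrow> p 0 = 0"
  using sublinear_scale[of p 0 0] by simp

lemma sublinear_minus: "sublinear p \<Longrightarrow> - p (- x) \<le> p x"
  using sublinear_add[of p x "- x"] sublinear_zero[of p] by simp

text \<open>The function \<open>q x = inf {p (x + t y) - t p y | t \<ge> 0}\<close> is the largest sublinear
  function below \<open>p\<close> that takes the value \<open>- p y\<close> at \<open>- y\<close>. It serves twice: a minimal sublinear
  function must equal its flattening in every direction, hence is odd and so linear; and one
  flattening ahead of the minimisation forces the linear minorant to touch \<open>p\<close> at \<open>y\<close>.\<close>

lemma sublinear_flatten:
  assumes p: "sublinear p"
  shows "\<exists>q. sublinear q \<and> q \<le> p \<and> q (- y) \<le> - p y"
proof -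
  define F where "F x t = p (x + t *\<^sub>R y) - t * p y" for x t
  define q where "q x = (INF t\<in>{0..}. F x t)" for x
  \<comment> \<open>Without this uniform lower bound the infimum would be meaningless.\<close>
  have low: "- p (- x) \<le> F x t" if "0 \<le> t" for x t
  proof -
    have "t * p y = p ((x + t *\<^sub>R y) + (- x))" using sublinear_scale[OF p that] by simp
    also have "\<dots> \<le> p (x + t *\<^sub>R y) + p (- x)" by (rule sublinear_add[OF p])
    finally show ?thesis by (simp add: F_def)
  qed
  have bdd: "bdd_below (F x ` {0..})" for x
    using low[of _ x] by (intro bdd_belowI2[where m = "- p (- x)"]) auto
  have q_le: "q x \<le> F x t" if "0 \<le> t" for x t
    unfolding q_def using that by (intro cINF_lower bdd) auto
  have q_ge: "a \<le> q x" if "\<And>t. 0 \<le> t \<Longrightarrow> a \<le> F x t" for a x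
    unfolding q_def using that by (intro cINF_greatest) auto
  have F_add: "q (x + z) \<le> F x s + F z t" if "0 \<le> s" "0 \<le> t" for x z s t
  proof -
    have "q (x + z) \<le> F (x + z) (s + t)" using that by (intro q_le) simp
    also have "\<dots> \<le> F x s + F z t"
      using sublinear_add[OF p, of "x + s *\<^sub>R y" "z + t *\<^sub>R y"]
      by (simp add: F_def algebra_simps)
    finally show ?thesis .
  qed
  have q_p: "q x \<le> p x" for x using q_le[of 0 x] by (simp add: F_def)
  have "sublinear q"
  proof (rule sublinearI)
    fix x z
    have "q (x + z) - q z \<le> q x"
    proof (rule q_ge)
      fix s :: real assume s: "0 \<le> s"
      have "q (x + z) - F x s \<le> q z" by (rule q_ge) (use F_add[OF s] in \<open>simp add: algebra_simps\<close>)
      then show "q (x + z) - q z \<le> F x s" by simp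
    qed
    then show "q (x + z) \<le> q x + q z" by simp
  next
    have "0 \<le> q 0" using low[of _ 0] sublinear_zero[OF p] by (intro q_ge) simp
    then show "q 0 = 0" using q_p[of 0] sublinear_zero[OF p] by simp
  next
    fix c :: real and x assume c: "0 < c"
    have "q (c *\<^sub>R x) / c \<le> q x"
    proof (rule q_ge)
      fix t :: real assume t: "0 \<le> t"
      have "q (c *\<^sub>R x) \<le> F (c *\<^sub>R x) (c * t)" using c t by (intro q_le) simp
      also have "F (c *\<^sub>R x) (c * t) = c * F x t"
        using sublinear_scale[OF p, of c "x + t *\<^sub>R y"] c
        by (simp add: F_def algebra_simps)
      finally show "q (c *\<^sub>R x) / c \<le> F x t" using c by (simp add: field_simps)
    qed
    then show "q (c *\<^sub>R x) \<le> c * q x" using c by (simp add: field_simps)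
  qed
  moreover have "q (- y) \<le> - p y"
    using q_le[of 1 "- y"] sublinear_zero[OF p] by (simp add: F_def)
  ultimately show ?thesis using q_p by (auto simp: le_fun_def)
qed

text \<open>Working with sublinear functions on the whole space, rather than with linear functionals on
  subspaces, makes the Zorn argument short: the infimum of a chain of sublinear functions below \<open>p\<close>
  is sublinear, so a minimal one exists, and minimality makes it linear.\<close>

lemma sublinear_dominates_linear:
  assumes p: "sublinear (p :: 'v::real_vector \<Rightarrow> real)"
  shows "\<exists>q. linear q \<and> q \<le> p"
proof -
  define A where "A = {q. sublinear q \<and> q \<le> p}"
  let ?R = "\<lambda>a b :: 'v \<Rightarrow> real. b \<le> a"
  have "\<exists>m\<in>A. \<forall>a\<in>A. ?R m a \<longrightarrow> a = m"
  proof (rule predicate_Zorn)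
    show "partial_order_on A (relation_of ?R A)"
      by (rule partial_order_on_relation_ofI) auto
  next
    fix C assume C: "C \<in> Chains (relation_of ?R A)"
    have CA: "C \<subseteq> A" using C by (auto simp: Chains_def relation_of_def)
    have chain: "a \<le> b \<or> b \<le> a" if "a \<in> C" "b \<in> C" for a b
      using C that by (auto simp: Chains_def relation_of_def)
    show "\<exists>u\<in>A. \<forall>a\<in>C. u \<le> a"
    proof (cases "C = {}")
      case True
      then show ?thesis using p by (auto simp: A_def)
    next
      case False
      define u where "u x = (INF q\<in>C. q x)" for x
      have low: "- p (- x) \<le> q x" if "q \<in> C" for q x
      proof -
        have "sublinear q" "q (- x) \<le> p (- x)" using that CA by (auto simp: A_def le_fun_def)
        then show ?thesis using sublinear_minus[of q x] by simp
      qed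
      have bdd: "bdd_below ((\<lambda>q. q x) ` C)" for x
        using low by (intro bdd_belowI2[where m = "- p (- x)"]) auto
      have u_le: "u x \<le> q x" if "q \<in> C" for q x
        unfolding u_def using that by (intro cINF_lower bdd)
      have u_ge: "a \<le> u x" if "\<And>q. q \<in> C \<Longrightarrow> a \<le> q x" for a x
        unfolding u_def using that False by (intro cINF_greatest) auto
      obtain q0 where q0: "q0 \<in> C" using False by auto
      have sub: "sublinear q" if "q \<in> C" for q using that CA by (auto simp: A_def)
      have "sublinear u"
      proof (rule sublinearI)
        fix x y
        \<comment> \<open>Different members of the chain may be nearly optimal at \<open>x\<close> and \<open>y\<close>; the smaller serves both.\<close>
        have *: "u (x + y) \<le> a x + b y" if "a \<in> C" "b \<in> C" for a b
          using chain[OF that]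
        proof
          assume "a \<le> b"
          then have "a y \<le> b y" by (simp add: le_fun_def)
          with u_le[OF that(1), of "x + y"] sublinear_add[OF sub[OF that(1)], of x y]
          show ?thesis by simp
        next
          assume "b \<le> a"
          then have "b x \<le> a x" by (simp add: le_fun_def)
          with u_le[OF that(2), of "x + y"] sublinear_add[OF sub[OF that(2)], of x y]
          show ?thesis by simp
        qed
        have "u (x + y) - u y \<le> u x"
        proof (rule u_ge)
          fix a assume a: "a \<in> C"
          have "u (x + y) - a x \<le> u y" by (rule u_ge) (use *[OF a] in \<open>simp add: algebra_simps\<close>)
          then show "u (x + y) - u y \<le> a x" by simp
        qed
        then show "u (x + y) \<le> u x + u y" by simp
      next
        show "u 0 = 0"
          using u_ge[of 0 0] u_le[OF q0, of 0] sublinear_zero[OF sub] q0 by (force intro: antisym)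
      next
        fix c :: real and x assume c: "0 < c"
        have "u (c *\<^sub>R x) / c \<le> u x"
        proof (rule u_ge)
          fix a assume a: "a \<in> C"
          show "u (c *\<^sub>R x) / c \<le> a x"
            using u_le[OF a, of "c *\<^sub>R x"] sublinear_scale[OF sub[OF a], of c x] c
            by (simp add: field_simps)
        qed
        then show "u (c *\<^sub>R x) \<le> c * u x" using c by (simp add: field_simps)
      qed
      moreover have "u \<le> p"
        using u_le[OF q0] q0 CA by (force simp: A_def le_fun_def intro: order_trans)
      ultimately show ?thesis using u_le by (auto simp: A_def le_fun_def)
    qed
  qed
  then obtain m where m: "m \<in> A" and min: "\<And>a. a \<in> A \<Longrightarrow> a \<le> m \<Longrightarrow> a = m" by blast
  have sub: "sublinear m" and mp: "m \<le> p" using m by (auto simp: A_def)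
  \<comment> \<open>Flattening in the direction \<open>y\<close> cannot lower a minimal function.\<close>
  have neg: "m (- y) = - m y" for y
  proof -
    obtain q where q: "sublinear q" "q \<le> m" "q (- y) \<le> - m y"
      using sublinear_flatten[OF sub] by blast
    then have "q = m" using mp by (intro min) (auto simp: A_def)
    with q(3) sublinear_minus[OF sub, of "- y"] show ?thesis by simp
  qed
  have "linear m"
  proof (rule linearI)
    fix x y
    have "m x \<le> m (x + y) + m (- y)" using sublinear_add[OF sub, of "x + y" "- y"] by simp
    then show "m (x + y) = m x + m y"
      using sublinear_add[OF sub, of x y] neg[of y] by simp
  next
    fix c :: real and x
    show "m (c *\<^sub>R x) = c *\<^sub>R m x"
    proof (cases "0 \<le> c")
      case True
      then show ?thesis using sublinear_scale[OF sub] by simp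
    next
      case False
      then show ?thesis
        using sublinear_scale[OF sub, of "- c" x] neg[of "(- c) *\<^sub>R x"] by simp
    qed
  qed
  with mp show ?thesis by blast
qed

theorem hahn_banach_point:
  assumes p: "sublinear (p :: 'v::real_vector \<Rightarrow> real)"
  shows "\<exists>q. linear q \<and> q \<le> p \<and> q y = p y"
proof -
  obtain p' where p': "sublinear p'" "p' \<le> p" "p' (- y) \<le> - p y"
    using sublinear_flatten[OF p] by blast
  obtain q where q: "linear q" "q \<le> p'" using sublinear_dominates_linear[OF p'(1)] by blast
  have "q (- y) \<le> - p y" using le_funD[OF q(2), of "- y"] p'(3) by linarith
  then have "p y \<le> q y" using linear_neg[OF q(1), of y] by simp
  moreover have "q \<le> p" using q p' by simp
  ultimately show ?thesis using q(1) by (intro exI[of _ q]) (simp add: le_fun_def order_antisym)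
qed

section \<open>Separation by linear functionals\<close>

text \<open>The set \<open>K = U - (C - c0)\<close> is convex and absorbing and misses \<open>c0 - p\<close>, so its gauge \<open>k\<close> is
  a sublinear function with \<open>k \<le> 1\<close> on \<open>K\<close> and \<open>k (c0 - p) \<ge> 1\<close>. A linear minorant of the gauge
  touching it at \<open>c0 - p\<close> separates, after a change of sign. No topology enters; the
  one-sided bound of \<open>\<psi>\<close> on \<open>U\<close> is what yields continuity of \<open>\<psi>\<close> once \<open>U\<close> is a neighbourhood of the origin.\<close>

lemma separation_algebraic:
  fixes C U :: "'v::real_vector set"
  assumes C: "convex C" and U: "convex U"
    and absorbing: "\<And>v. \<exists>e>0. e *\<^sub>R v \<in> U"
    and disjoint: "\<And>u. u \<in> U \<Longrightarrow> p + u \<notin> C"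
  shows "\<exists>\<psi> \<gamma> M. linear \<psi> \<and> (\<forall>c\<in>C. \<psi> c \<le> \<gamma>) \<and> \<gamma> < \<psi> p \<and> (\<forall>u\<in>U. - \<psi> u \<le> (M::real))"
proof (cases "C = {}")
  case True
  then show ?thesis
    by (intro exI[of _ "\<lambda>_. 0"] exI[of _ "- 1"] exI[of _ 0]) (simp add: linear_iff)
next
  case False
  then obtain c0 where c0: "c0 \<in> C" by blast
  have U0: "0 \<in> U" using absorbing[of 0] by simp
  define d where "d = p - c0"
  define K where "K = {u - (c - c0) | u c. u \<in> U \<and> c \<in> C}"
  have K_mem: "u - (c - c0) \<in> K" if "u \<in> U" "c \<in> C" for u c
    using that by (auto simp: K_def)
  have K_conv: "a *\<^sub>R x + b *\<^sub>R y \<in> K"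
    if K: "x \<in> K" "y \<in> K" and ab: "0 \<le> a" "0 \<le> b" "a + b = 1" for x y a b
  proof -
    obtain u c where uc: "u \<in> U" "c \<in> C" "x = u - (c - c0)"
      using K(1) by (auto simp: K_def)
    obtain u' c' where uc': "u' \<in> U" "c' \<in> C" "y = u' - (c' - c0)"
      using K(2) by (auto simp: K_def)
    have "a *\<^sub>R x + b *\<^sub>R y = (a *\<^sub>R u + b *\<^sub>R u') - ((a *\<^sub>R c + b *\<^sub>R c') - (a + b) *\<^sub>R c0)"
      by (simp add: uc(3) uc'(3) algebra_simps)
    also have "\<dots> \<in> K"
      using K_mem[OF convexD[OF U uc(1) uc'(1) ab] convexD[OF C uc(2) uc'(2) ab]] ab(3)
      by simp
    finally show ?thesis .
  qed
  have UK: "u \<in> K" if "u \<in> U" for u using K_mem[OF that c0] by simp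
  have K0: "0 \<in> K" using UK U0 .
  have dK: "- d \<notin> K"
  proof
    assume "- d \<in> K"
    then obtain u c where "u \<in> U" "c \<in> C" "- d = u - (c - c0)" by (auto simp: K_def)
    then have "p + u = c" by (simp add: d_def algebra_simps)
    then show False using disjoint \<open>u \<in> U\<close> \<open>c \<in> C\<close> by blast
  qed
  define G where "G x = {r. 0 < r \<and> inverse r *\<^sub>R x \<in> K}" for x
  define k where "k x = Inf (G x)" for x
  have G_ne: "G x \<noteq> {}" for x
  proof -
    obtain e where "e > 0" "e *\<^sub>R x \<in> U" using absorbing by blast
    then have "inverse e \<in> G x" using UK by (simp add: G_def)
    then show ?thesis by blast
  qed
  have G_bdd: "bdd_below (G x)" for x by (intro bdd_belowI[of _ 0]) (auto simp: G_def)
  have k_le: "k x \<le> r" if "r \<in> G x" for x r unfolding k_def using that G_bdd by (rule cInf_lower)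
  have k_ge: "a \<le> k x" if "\<And>r. r \<in> G x \<Longrightarrow> a \<le> r" for a x
    unfolding k_def using that G_ne by (intro cInf_greatest) auto
  have G_add: "r + s \<in> G (x + y)" if "r \<in> G x" "s \<in> G y" for r s x y
  proof -
    have rs: "0 < r" "0 < s" "inverse r *\<^sub>R x \<in> K" "inverse s *\<^sub>R y \<in> K"
      using that by (auto simp: G_def)
    have "(r / (r + s)) *\<^sub>R (inverse r *\<^sub>R x) + (s / (r + s)) *\<^sub>R (inverse s *\<^sub>R y) \<in> K"
      using rs by (intro K_conv) (auto simp flip: add_divide_distrib)
    moreover have "r / (r + s) * inverse r = inverse (r + s)" "s / (r + s) * inverse s = inverse (r + s)"
      using rs by (simp_all add: divide_inverse)
    then have "(r / (r + s)) *\<^sub>R (inverse r *\<^sub>R x) + (s / (r + s)) *\<^sub>R (inverse s *\<^sub>R y)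
        = inverse (r + s) *\<^sub>R (x + y)"
      by (simp add: scaleR_add_right)
    ultimately show ?thesis using rs by (simp add: G_def)
  qed
  have k_sub: "sublinear k"
  proof (rule sublinearI)
    fix x y
    have "k (x + y) - k y \<le> k x"
    proof (rule k_ge)
      fix r assume r: "r \<in> G x"
      have "k (x + y) - r \<le> s" if "s \<in> G y" for s
        using k_le[OF G_add[OF r that]] by simp
      then have "k (x + y) - r \<le> k y" by (rule k_ge)
      then show "k (x + y) - k y \<le> r" by simp
    qed
    then show "k (x + y) \<le> k x + k y" by simp
  next
    have "r \<in> G 0" if "0 < r" for r using that K0 by (simp add: G_def)
    then have "k 0 \<le> r" if "0 < r" for r using that k_le by blast
    then have "k 0 \<le> 0" by (rule field_le_epsilon[of _ 0, simplified])
    moreover have "0 \<le> k 0" by (rule k_ge) (simp add: G_def)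
    ultimately show "k 0 = 0" by simp
  next
    fix c :: real and x assume c: "0 < c"
    have "k (c *\<^sub>R x) / c \<le> k x"
    proof (rule k_ge)
      fix r assume r: "r \<in> G x"
      have scaled: "inverse (c * r) *\<^sub>R c *\<^sub>R x = inverse r *\<^sub>R x" using c by simp
      have "c * r \<in> G (c *\<^sub>R x)" unfolding G_def mem_Collect_eq scaled
        using r c by (simp add: G_def)
      from k_le[OF this] show "k (c *\<^sub>R x) / c \<le> r" using c by (simp add: field_simps)
    qed
    then show "k (c *\<^sub>R x) \<le> c * k x" using c by (simp add: field_simps)
  qed
  have k1: "k x \<le> 1" if "x \<in> K" for x by (rule k_le) (use that in \<open>simp add: G_def\<close>)
  have kd: "1 \<le> k (- d)"
  proof (rule k_ge)
    fix r assume "r \<in> G (- d)"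
    then have r: "0 < r" "inverse r *\<^sub>R (- d) \<in> K" by (auto simp: G_def)
    show "1 \<le> r"
    proof (rule ccontr)
      assume "\<not> 1 \<le> r"
      then have "r *\<^sub>R (inverse r *\<^sub>R (- d)) + (1 - r) *\<^sub>R 0 \<in> K"
        using r K0 by (intro K_conv) auto
      then show False using r(1) dK by simp
    qed
  qed
  obtain q where q: "linear q" "q \<le> k" "q (- d) = k (- d)"
    using hahn_banach_point[OF k_sub] by blast
  define \<psi> where "\<psi> x = - q x" for x
  have lin: "linear \<psi>" unfolding \<psi>_def using q(1) by (simp add: linear_iff)
  have \<psi>d: "1 \<le> \<psi> d" using kd q(3) linear_neg[OF q(1), of d] by (simp add: \<psi>_def)
  have main: "\<psi> c \<le> \<psi> p + \<psi> u" if "u \<in> U" "c \<in> C" for u c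
  proof -
    have "q (u - (c - c0)) \<le> k (u - (c - c0))" using q(2) by (simp add: le_fun_def)
    then have "q (u - (c - c0)) \<le> q (- d)" using k1[OF K_mem[OF that]] q(3) kd by linarith
    then show ?thesis
      using q(1) by (simp add: \<psi>_def d_def linear_diff linear_add linear_neg)
  qed
  obtain e where e: "e > 0" "e *\<^sub>R (- d) \<in> U" using absorbing by blast
  have "\<psi> (e *\<^sub>R (- d)) < 0"
    using e(1) \<psi>d lin by (simp add: linear_scale linear_neg)
  \<comment> \<open>Absorption makes the separation strict: some \<open>u \<in> U\<close> has \<open>\<psi> u < 0\<close>.\<close>
  then show ?thesis
    using lin main[OF e(2)] main[OF _ c0]
    by (intro exI[of _ \<psi>] exI[of _ "\<psi> p + \<psi> (e *\<^sub>R (- d))"] exI[of _ "\<psi> p - \<psi> c0"])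
       (auto simp: algebra_simps)
qed

text \<open>A functional vanishing on the common kernel of finitely many functionals is a combination of
  them. Adding a functional \<open>F j\<close>, one subtracts from \<open>\<psi>\<close> the multiple of \<open>F j\<close> that makes it vanish
  at some \<open>v\<close> in the kernel of the others; if no \<open>v\<close> there has \<open>F j v \<noteq> 0\<close>, then \<open>F j\<close> is superfluous.\<close>

lemma linear_combination_of_kernels:
  fixes F :: "'i \<Rightarrow> 'v::real_vector \<Rightarrow> real"
  assumes "finite I" and "\<And>i. i \<in> I \<Longrightarrow> linear (F i)" and "linear \<psi>"
    and "\<And>v. (\<And>i. i \<in> I \<Longrightarrow> F i v = 0) \<Longrightarrow> \<psi> v = 0"
  shows "\<exists>c. \<forall>v. \<psi> v = (\<Sum>i\<in>I. c i * F i v)"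
  using assms
proof (induction I arbitrary: \<psi> rule: finite_induct)
  case empty
  then show ?case by simp
next
  case (insert j I)
  show ?case
  proof (cases "\<exists>v. (\<forall>i\<in>I. F i v = 0) \<and> F j v \<noteq> 0")
    case True
    then obtain v where v: "\<And>i. i \<in> I \<Longrightarrow> F i v = 0" "F j v \<noteq> 0" by blast
    define a where "a = \<psi> v / F j v"
    have lj: "linear (F j)" using insert.prems by simp
    have "\<exists>c. \<forall>w. \<psi> w - a * F j w = (\<Sum>i\<in>I. c i * F i w)"
    proof (rule insert.IH)
      show "linear (\<lambda>w. \<psi> w - a * F j w)"
        using insert.prems(2) lj by (simp add: linear_iff algebra_simps)
      fix w assume w: "\<And>i. i \<in> I \<Longrightarrow> F i w = 0"
      have "\<psi> (w - (F j w / F j v) *\<^sub>R v) = 0"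
      proof (rule insert.prems(3))
        fix i assume "i \<in> insert j I"
        moreover from this have "linear (F i)" using insert.prems by blast
        ultimately show "F i (w - (F j w / F j v) *\<^sub>R v) = 0"
          using v w by (auto simp: linear_diff linear_scale)
      qed
      then show "\<psi> w - a * F j w = 0"
        using insert.prems(2) by (simp add: a_def linear_diff linear_scale field_simps)
    qed (use insert.prems in auto)
    then obtain c where c: "\<And>w. \<psi> w - a * F j w = (\<Sum>i\<in>I. c i * F i w)" by blast
    have expand: "(\<Sum>i\<in>insert j I. (c(j := a)) i * F i w) = a * F j w + (\<Sum>i\<in>I. c i * F i w)" for w
      using insert.hyps by (auto intro!: sum.cong)
    then have "\<psi> w = (\<Sum>i\<in>insert j I. (c(j := a)) i * F i w)" for w
      unfolding expand using c[of w] by linarith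
    then show ?thesis by blast
  next
    case False
    then have "\<exists>c. \<forall>w. \<psi> w = (\<Sum>i\<in>I. c i * F i w)"
      using insert.prems by (intro insert.IH) auto
    then obtain c where c: "\<And>w. \<psi> w = (\<Sum>i\<in>I. c i * F i w)" by blast
    have expand: "(\<Sum>i\<in>insert j I. (c(j := 0)) i * F i w) = (\<Sum>i\<in>I. c i * F i w)" for w
      using insert.hyps by (auto intro!: sum.cong)
    then have "\<psi> w = (\<Sum>i\<in>insert j I. (c(j := 0)) i * F i w)" for w
      unfolding expand using c[of w] by linarith
    then show ?thesis by blast
  qed
qed

section \<open>Separation by continuous functionals\<close>

lemma tendsto_scaleR_tvs:
  fixes b :: "'b \<Rightarrow> 'a::topological_real_vector"
  assumes "(a \<longlongrightarrow> c) F" "(b \<longlongrightarrow> x) F"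
  shows "((\<lambda>t. a t *\<^sub>R b t) \<longlongrightarrow> c *\<^sub>R x) F"
  using filterlim_compose[OF tendsto_scaleR_nhds filterlim_Pair[OF assms]] by simp

lemma eventually_absorbed:
  fixes U :: "'a::topological_real_vector set"
  assumes "open U" "0 \<in> U"
  shows "\<forall>\<^sub>F t in at_right 0. t *\<^sub>R v \<in> U"
proof -
  have "((\<lambda>t. t *\<^sub>R v) \<longlongrightarrow> 0 *\<^sub>R v) (at_right 0)"
    by (intro tendsto_scaleR_tvs tendsto_const tendsto_ident_at)
  then show ?thesis using assms by (simp add: tendsto_def)
qed

lemma eventually_absorbed_real: "0 < e \<Longrightarrow> \<forall>\<^sub>F t::real in at_right 0. \<bar>t * s\<bar> < e"
proof -
  assume e: "0 < e"
  have "((\<lambda>t. t * s) \<longlongrightarrow> 0 * s) (at_right 0)"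
    by (intro tendsto_intros)
  from tendstoD[OF this e] show ?thesis by (simp add: dist_real_def)
qed

lemma eventually_at_right_obtain:
  assumes "\<forall>\<^sub>F t::real in at_right 0. P t"
  shows "\<exists>t>0. P t"
  using eventually_happens'[OF _ eventually_conj[OF assms eventually_at_right_less[of 0]]]
  by auto

text \<open>On the symmetric neighbourhood \<open>V \<inter> - V\<close> the one-sided bound becomes \<open>\<bar>\<psi>\<bar> \<le> M\<close>;
  shrinking this neighbourhood by a factor shrinks the bound by the same factor.\<close>

lemma linear_bounded_continuous:
  fixes \<psi> :: "'a::topological_real_vector \<Rightarrow> real"
  assumes lin: "linear \<psi>" and V: "open V" "0 \<in> V" and M: "\<And>v. v \<in> V \<Longrightarrow> - \<psi> v \<le> M"
  shows "continuous_on UNIV \<psi>"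
proof -
  define N where "N = V \<inter> uminus -` V"
  have "open N" unfolding N_def
    using V by (intro open_Int open_vimage continuous_intros) auto
  have N0: "0 \<in> N" using V by (simp add: N_def)
  have abs: "\<bar>\<psi> v\<bar> \<le> M" if "v \<in> N" for v
    using that M[of v] M[of "- v"] linear_neg[OF lin, of v] by (auto simp: N_def)
  have M0: "0 \<le> M" using abs[OF N0] by simp
  have "(\<psi> \<longlongrightarrow> \<psi> x) (at x)" for x
  proof (rule tendstoI)
    fix e :: real assume e: "0 < e"
    define c where "c = (M + 1) / e"
    have c: "0 < c" using e M0 by (simp add: c_def)
    have "((\<lambda>y. c *\<^sub>R (y - x)) \<longlongrightarrow> c *\<^sub>R (x - x)) (at x)"
      by (intro tendsto_scaleR_tvs tendsto_const tendsto_diff tendsto_ident_at)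
    then have "\<forall>\<^sub>F y in at x. c *\<^sub>R (y - x) \<in> N"
      using \<open>open N\<close> N0 by (simp add: tendsto_def)
    then show "\<forall>\<^sub>F y in at x. dist (\<psi> y) (\<psi> x) < e"
    proof eventually_elim
      case (elim y)
      have "c * \<bar>\<psi> y - \<psi> x\<bar> \<le> M"
        using abs[OF elim] c
        unfolding linear_scale[OF lin] linear_diff[OF lin] by (simp add: abs_mult)
      also have "M < c * e" using e by (simp add: c_def)
      finally show ?case using c by (simp add: dist_real_def)
    qed
  qed
  then show ?thesis by (simp add: continuous_on_def)
qed

lemma linear_prod_real:
  fixes \<psi> :: "'v::real_vector \<times> real \<Rightarrow> real"
  assumes "linear \<psi>"
  shows "\<psi> (y, s) = \<psi> (y, 0) + \<psi> (0, 1) * s" and "linear (\<lambda>y. \<psi> (y, 0))"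
proof -
  have "\<psi> (y, s) = \<psi> ((y, 0) + s *\<^sub>R (0, 1))" by simp
  also have "\<dots> = \<psi> (y, 0) + \<psi> (0, 1) * s"
    unfolding linear_add[OF assms] linear_scale[OF assms] by simp
  finally show "\<psi> (y, s) = \<psi> (y, 0) + \<psi> (0, 1) * s" .
  have "\<psi> (x + y, 0) = \<psi> (x, 0) + \<psi> (y, 0)" for x y
    using linear_add[OF assms, of "(x, 0)" "(y, 0)"] by simp
  moreover have "\<psi> (c *\<^sub>R x, 0) = c * \<psi> (x, 0)" for c x
    using linear_scale[OF assms, of c "(x, 0)"] by simp
  ultimately show "linear (\<lambda>y. \<psi> (y, 0))" by (simp add: linear_iff)
qed

text \<open>In \<open>X \<times> \<real>\<close> a point outside the closure has a convex product neighbourhood missing \<open>C\<close>, by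
  local convexity, so the algebraic separation applies and its functional is continuous. Stating the
  hypothesis for the closure of a convex set avoids having to know that this closure is convex.\<close>

lemma separation_primal:
  fixes C :: "('a::locally_convex_space \<times> real) set"
  assumes C: "convex C" and out: "(x, r) \<notin> closure C"
  shows "\<exists>\<phi> \<alpha> \<gamma>. (\<forall>(y, s)\<in>C. dual_apply \<phi> y + \<alpha> * s \<le> \<gamma>) \<and> \<gamma> < dual_apply \<phi> x + \<alpha> * r"
proof -
  have "open (- closure C)" "(x, r) \<in> - closure C" using out by auto
  then obtain A B where AB: "open A" "open B" "(x, r) \<in> A \<times> B" "A \<times> B \<subseteq> - closure C"
    by (rule open_prod_elim)
  obtain e where e: "0 < e" "ball r e \<subseteq> B" using AB openE by (metis mem_Sigma_iff)
  have "open ((\<lambda>v. x + v) -` A)"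
    using AB(1) by (intro open_vimage continuous_intros)
  moreover have "0 \<in> (\<lambda>v. x + v) -` A" using AB(3) by simp
  ultimately obtain V where V: "open V" "convex V" "0 \<in> V" "V \<subseteq> (\<lambda>v. x + v) -` A"
    using locally_convex_at_0_convex by blast
  have "\<exists>\<psi> \<gamma> M. linear \<psi> \<and> (\<forall>c\<in>C. \<psi> c \<le> \<gamma>) \<and> \<gamma> < \<psi> (x, r) \<and> (\<forall>u\<in>V \<times> ball 0 e. - \<psi> u \<le> (M::real))"
  proof (rule separation_algebraic[OF C])
    show "convex (V \<times> ball (0::real) e)" using V(2) by (intro convex_Times convex_ball)
    show "\<exists>t>0. t *\<^sub>R v \<in> V \<times> ball 0 e" for v :: "'a \<times> real"
    proof -
      have "\<forall>\<^sub>F t in at_right 0. t *\<^sub>R fst v \<in> V \<and> \<bar>t * snd v\<bar> < e"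
        using V e by (intro eventually_conj eventually_absorbed eventually_absorbed_real)
      from eventually_at_right_obtain[OF this] show ?thesis by (auto simp: mem_Times_iff)
    qed
    show "(x, r) + u \<notin> C" if "u \<in> V \<times> ball 0 e" for u
    proof -
      have "r + snd u \<in> ball r e" using that by (simp add: mem_Times_iff dist_real_def)
      then have "r + snd u \<in> B" using e(2) by blast
      moreover have "x + fst u \<in> A" using that V(4) by (auto simp: mem_Times_iff)
      ultimately have "(x, r) + u \<in> A \<times> B" by (simp add: mem_Times_iff)
      from subsetD[OF AB(4) this] show ?thesis using closure_subset[of C] by auto
    qed
  qed
  then obtain \<psi> \<gamma> M where \<psi>: "linear \<psi>" "\<forall>c\<in>C. \<psi> c \<le> \<gamma>" "\<gamma> < \<psi> (x, r)"
    "\<forall>u\<in>V \<times> ball 0 e. - \<psi> u \<le> (M::real)" by blast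
  note split = linear_prod_real[OF \<psi>(1)]
  have "continuous_on UNIV (\<lambda>y. \<psi> (y, 0))"
    by (rule linear_bounded_continuous[OF split(2) V(1,3), of M]) (use \<psi>(4) e in auto)
  then have "dual_apply (Abs_dual (\<lambda>y. \<psi> (y, 0))) = (\<lambda>y. \<psi> (y, 0))"
    using split(2) by (intro Abs_dual_inverse) simp
  then have "\<psi> (y, s) = dual_apply (Abs_dual (\<lambda>y. \<psi> (y, 0))) y + \<psi> (0, 1) * s" for y s
    using split(1)[of y s] by simp
  with \<psi>(2,3) show ?thesis by (metis (no_types, lifting) case_prodI2)
qed

lemma dual_apply_linear: "linear (dual_apply \<phi>)"
  using dual_apply[of \<phi>] by simp

lemma evaluation_linear: "linear (\<lambda>\<phi>. dual_apply \<phi> x)"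
  by (simp add: linear_iff plus_dual.rep_eq scaleR_dual.rep_eq)

lemma evaluation_continuous: "continuous_on S (\<lambda>\<phi>. dual_apply \<phi> x)"
proof -
  have "open ((\<lambda>\<phi>. dual_apply \<phi> x) -` B)" if "open B" for B
  proof -
    have "open ((\<lambda>h::'a \<Rightarrow> real. h x) -` B)"
      using that by (intro open_vimage continuous_on_product_coordinates)
    then show ?thesis unfolding open_dual_def openin_pullback_topology
      by (intro exI[of _ "(\<lambda>h. h x) -` B"]) auto
  qed
  then have "continuous_on UNIV (\<lambda>\<phi>. dual_apply \<phi> x)"
    by (simp add: continuous_on_open_vimage)
  then show ?thesis by (rule continuous_on_subset) simp
qed

text \<open>A weak* neighbourhood only restricts finitely many values, and all of them by a common
  tolerance. This finiteness is what makes weak* continuous functionals evaluations.\<close>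

lemma weak_star_neighbourhood:
  assumes "open A" "\<phi> \<in> A"
  shows "\<exists>I e. finite I \<and> 0 < e \<and>
    (\<forall>\<psi>. (\<forall>i\<in>I. \<bar>dual_apply \<psi> i - dual_apply \<phi> i\<bar> < e) \<longrightarrow> \<psi> \<in> A)"
proof -
  obtain W where W: "open W" "A = dual_apply -` W"
    using assms(1) unfolding open_dual_def openin_pullback_topology by auto
  have "openin (product_topology (\<lambda>_. euclidean) UNIV) W" using W(1) by (simp add: open_fun_def)
  from product_topology_open_contains_basis[OF this, of "dual_apply \<phi>"]
  obtain X where X: "dual_apply \<phi> \<in> (\<Pi>\<^sub>E i\<in>UNIV. X i)" "\<And>i. open (X i)"
    "finite {i. X i \<noteq> UNIV}" "(\<Pi>\<^sub>E i\<in>UNIV. X i) \<subseteq> W"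
    using assms(2) W(2) by auto
  define I where "I = {i. X i \<noteq> UNIV}"
  have "\<forall>i\<in>I. \<forall>\<^sub>F e in at_right 0. ball (dual_apply \<phi> i) e \<subseteq> X i"
  proof
    fix i
    have "dual_apply \<phi> i \<in> X i" using X(1) by (auto simp: PiE_iff)
    then obtain d where d: "0 < d" "ball (dual_apply \<phi> i) d \<subseteq> X i" using X(2) openE by blast
    then have "ball (dual_apply \<phi> i) e \<subseteq> X i" if "0 < e" "e < d" for e using that by auto
    then show "\<forall>\<^sub>F e in at_right 0. ball (dual_apply \<phi> i) e \<subseteq> X i"
      using d(1) unfolding eventually_at_right_field by blast
  qed
  then have "\<forall>\<^sub>F e in at_right 0. \<forall>i\<in>I. ball (dual_apply \<phi> i) e \<subseteq> X i"
    using X(3) by (intro eventually_ball_finite) (simp_all add: I_def)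
  from eventually_at_right_obtain[OF this]
  obtain e where e: "0 < e" "\<And>i. i \<in> I \<Longrightarrow> ball (dual_apply \<phi> i) e \<subseteq> X i" by blast
  have "\<psi> \<in> A" if "\<forall>i\<in>I. \<bar>dual_apply \<psi> i - dual_apply \<phi> i\<bar> < e" for \<psi>
  proof -
    have "dual_apply \<psi> i \<in> X i" for i
    proof (cases "i \<in> I")
      case True
      then have "dual_apply \<psi> i \<in> ball (dual_apply \<phi> i) e"
        using that by (auto simp: dist_real_def abs_minus_commute)
      then show ?thesis using e(2) True by blast
    next
      case False
      then show ?thesis by (simp add: I_def)
    qed
    then show ?thesis using X(4) W(2) by (auto simp: PiE_iff)
  qed
  then show ?thesis using X(3) e(1) unfolding I_def by blast
qed

text \<open>The separating functional on \<open>X* \<times> \<real>\<close> is bounded on one side on a set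
  \<open>{\<psi>. \<forall>i\<in>I. \<bar>\<psi> i\<bar> < e}\<close> with \<open>I\<close> finite, hence vanishes on every \<open>\<psi>\<close> that is zero on \<open>I\<close>; by the
  kernel lemma its restriction to \<open>X*\<close> is then evaluation at a combination \<open>x\<close> of the elements of \<open>I\<close>.\<close>

lemma separation_weak_star:
  fixes C :: "('a::locally_convex_space dual \<times> real) set"
  assumes C: "convex C" and out: "(\<phi>, r) \<notin> closure C"
  shows "\<exists>x \<alpha> \<gamma>. (\<forall>(\<psi>, s)\<in>C. dual_apply \<psi> x + \<alpha> * s \<le> \<gamma>) \<and> \<gamma> < dual_apply \<phi> x + \<alpha> * r"
proof -
  have "open (- closure C)" "(\<phi>, r) \<in> - closure C" using out by auto
  then obtain A B where AB: "open A" "open B" "(\<phi>, r) \<in> A \<times> B" "A \<times> B \<subseteq> - closure C"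
    by (rule open_prod_elim)
  obtain e0 where e0: "0 < e0" "ball r e0 \<subseteq> B" using AB openE by (metis mem_Sigma_iff)
  obtain I e where I: "finite I" "0 < e"
    "\<And>\<psi>. (\<forall>i\<in>I. \<bar>dual_apply \<psi> i - dual_apply \<phi> i\<bar> < e) \<Longrightarrow> \<psi> \<in> A"
    using weak_star_neighbourhood[OF AB(1), of \<phi>] AB(3) by auto
  define V where "V = (\<Inter>i\<in>I. (\<lambda>\<psi>. dual_apply \<psi> i) -` ball 0 e)"
  have V_iff: "\<psi> \<in> V \<longleftrightarrow> (\<forall>i\<in>I. \<bar>dual_apply \<psi> i\<bar> < e)" for \<psi>
    by (auto simp: V_def)
  have "\<exists>\<psi> \<gamma> M. linear \<psi> \<and> (\<forall>c\<in>C. \<psi> c \<le> \<gamma>) \<and> \<gamma> < \<psi> (\<phi>, r) \<and> (\<forall>u\<in>V \<times> ball 0 e0. - \<psi> u \<le> (M::real))"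
  proof (rule separation_algebraic[OF C])
    show "convex (V \<times> ball (0::real) e0)" unfolding V_def
      by (intro convex_Times convex_ball convex_INT convex_linear_vimage evaluation_linear)
    show "\<exists>t>0. t *\<^sub>R v \<in> V \<times> ball 0 e0" for v :: "'a dual \<times> real"
    proof -
      have "\<forall>\<^sub>F t in at_right 0. (\<forall>i\<in>I. \<bar>t * dual_apply (fst v) i\<bar> < e) \<and> \<bar>t * snd v\<bar> < e0"
        using I e0
        by (intro eventually_conj eventually_ball_finite ballI eventually_absorbed_real) auto
      from eventually_at_right_obtain[OF this] show ?thesis
        by (auto simp: mem_Times_iff V_iff scaleR_dual.rep_eq)
    qed
    show "(\<phi>, r) + u \<notin> C" if "u \<in> V \<times> ball 0 e0" for u
    proof -
      have "\<phi> + fst u \<in> A"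
        using that by (intro I(3)) (auto simp: V_iff plus_dual.rep_eq)
      moreover have "r + snd u \<in> ball r e0" using that by (simp add: mem_Times_iff dist_real_def)
      then have "r + snd u \<in> B" using e0(2) by blast
      ultimately have "(\<phi>, r) + u \<in> A \<times> B" by (simp add: mem_Times_iff)
      from subsetD[OF AB(4) this] show ?thesis using closure_subset[of C] by auto
    qed
  qed
  then obtain \<psi> \<gamma> M where \<psi>: "linear \<psi>" "\<forall>c\<in>C. \<psi> c \<le> \<gamma>" "\<gamma> < \<psi> (\<phi>, r)"
    "\<forall>u\<in>V \<times> ball 0 e0. - \<psi> u \<le> (M::real)" by blast
  note split = linear_prod_real[OF \<psi>(1)]
  have "\<exists>c. \<forall>\<eta>. \<psi> (\<eta>, 0) = (\<Sum>i\<in>I. c i * dual_apply \<eta> i)"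
  proof (rule linear_combination_of_kernels[OF I(1) _ split(2)])
    fix \<eta> :: "'a dual"
    assume zero: "\<And>i. i \<in> I \<Longrightarrow> dual_apply \<eta> i = 0"
    \<comment> \<open>The whole line through such an element stays in the neighbourhood.\<close>
    have bound: "- (t * \<psi> (\<eta>, 0)) \<le> M" for t
    proof -
      have "(t *\<^sub>R \<eta>, 0) \<in> V \<times> ball 0 e0"
        using zero I e0 by (auto simp: V_iff scaleR_dual.rep_eq)
      then have "- \<psi> (t *\<^sub>R \<eta>, 0) \<le> M" using \<psi>(4) by blast
      then show ?thesis using linear_scale[OF split(2), of t \<eta>] by simp
    qed
    show "\<psi> (\<eta>, 0) = 0"
    proof (rule ccontr)
      assume "\<psi> (\<eta>, 0) \<noteq> 0"
      then show False using bound[of "- (M + 1) / \<psi> (\<eta>, 0)"] by simp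
    qed
  qed (rule evaluation_linear)
  then obtain c where c: "\<And>\<eta>. \<psi> (\<eta>, 0) = (\<Sum>i\<in>I. c i * dual_apply \<eta> i)" by blast
  define x where "x = (\<Sum>i\<in>I. c i *\<^sub>R i)"
  have "\<psi> (\<eta>, s) = dual_apply \<eta> x + \<psi> (0, 1) * s" for \<eta> s
    unfolding split(1)[of \<eta> s] c x_def
    by (simp add: linear_sum[OF dual_apply_linear] linear_scale[OF dual_apply_linear])
  with \<psi>(2,3) show ?thesis by (metis (no_types, lifting) case_prodI2)
qed

section \<open>Conjugate functions\<close>

lemma lsc_closed_epigraph:
  assumes "lsc_fun h"
  shows "closed (epigraph h)"
  unfolding closed_def
proof (rule open_prod_intro)
  fix z assume "z \<in> - epigraph h"
  then obtain x r where z: "z = (x, r)" "ereal r < h x" by (cases z) (auto simp: epigraph_def)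
  obtain m where m: "r < m" "ereal m < h x" using ereal_dense2[OF z(2)] by auto
  have "\<forall>\<^sub>F y in nhds x. ereal m < h y" using assms m(2) by (simp add: lsc_fun_def)
  then obtain A where A: "open A" "x \<in> A" "\<And>y. y \<in> A \<Longrightarrow> ereal m < h y"
    by (auto simp: eventually_nhds)
  have "(y, s) \<notin> epigraph h" if "y \<in> A" "s < m" for y s
  proof -
    have "ereal s < ereal m" using that(2) by simp
    also have "ereal m < h y" using that(1) by (rule A(3))
    finally show ?thesis by (simp add: epigraph_def)
  qed
  then have "A \<times> {..<m} \<subseteq> - epigraph h" by auto
  then show "\<exists>A B. open A \<and> open B \<and> z \<in> A \<times> B \<and> A \<times> B \<subseteq> - epigraph h"
    using A z m by (intro exI[of _ A] exI[of _ "{..<m}"]) auto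
qed

lemma epigraph_mono: "(x, r) \<in> epigraph h \<Longrightarrow> r \<le> s \<Longrightarrow> (x, s) \<in> epigraph h"
  by (auto simp: epigraph_def intro: order_trans)

text \<open>Seen from the epigraph of \<open>h\<close>, a conjugate inequality is a family of real inequalities, one
  per point of the epigraph; infinite values of \<open>h\<close> need no separate treatment afterwards.\<close>

lemma mem_epigraph_conjugate:
  "(\<phi>, r) \<in> epigraph (conjugate h) \<longleftrightarrow> (\<forall>(x, s)\<in>epigraph h. dual_apply \<phi> x \<le> r + s)"
proof -
  have "ereal a - h x \<le> ereal r \<longleftrightarrow> (\<forall>s. h x \<le> ereal s \<longrightarrow> a \<le> r + s)" for a x
  proof (cases "h x")
    case (real u)
    then show ?thesis by (auto intro: order_trans)
  next
    case MInf
    then show ?thesis by (auto intro!: exI[of _ "a - r - 1"])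
  qed auto
  then show ?thesis unfolding epigraph_def conjugate_def by (auto simp: SUP_le_iff)
qed

lemma closed_epigraph_conjugate: "closed (epigraph (conjugate h))"
proof -
  have "epigraph (conjugate h) = (\<Inter>p\<in>epigraph h. {z. dual_apply (fst z) (fst p) \<le> snd z + snd p})"
    by (force simp: mem_epigraph_conjugate)
  moreover have "continuous_on UNIV (\<lambda>z :: 'a dual \<times> real. dual_apply (fst z) x)" for x
    using continuous_on_compose2[OF evaluation_continuous continuous_on_fst[OF continuous_on_id]]
    by auto
  ultimately show ?thesis
    by (auto intro!: closed_INT closed_Collect_le continuous_intros)
qed

lemma convex_epigraph_conjugate: "convex (epigraph (conjugate h))"
proof (rule convexI)
  fix z w :: "'a dual \<times> real" and u v :: real
  assume *: "z \<in> epigraph (conjugate h)" "w \<in> epigraph (conjugate h)" "0 \<le> u" "0 \<le> v" "u + v = 1"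
  obtain \<phi> r \<psi> q where zw: "z = (\<phi>, r)" "w = (\<psi>, q)" by (cases z, cases w)
  have "u * dual_apply \<phi> x + v * dual_apply \<psi> x \<le> u * r + v * q + s" if "(x, s) \<in> epigraph h" for x s
  proof -
    have "u * dual_apply \<phi> x + v * dual_apply \<psi> x \<le> u * (r + s) + v * (q + s)"
      using * that zw by (intro add_mono mult_left_mono) (auto simp: mem_epigraph_conjugate)
    also have "\<dots> = u * r + v * q + (u + v) * s" by (simp add: algebra_simps)
    finally show ?thesis using *(5) by simp
  qed
  then show "u *\<^sub>R z + v *\<^sub>R w \<in> epigraph (conjugate h)"
    by (auto simp: zw mem_epigraph_conjugate plus_dual.rep_eq scaleR_dual.rep_eq)
qed

text \<open>Epigraphs are unbounded upwards, so a half-space \<open>\<phi> y + \<alpha> * s \<le> \<gamma>\<close> containing one has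
  \<open>\<alpha> \<le> 0\<close>. The same estimate turns a bound along a ray into a sign condition.\<close>

lemma upward_slope_nonpos:
  fixes \<alpha> :: real
  assumes "\<And>s. s0 \<le> s \<Longrightarrow> a + \<alpha> * s \<le> \<gamma>"
  shows "\<alpha> \<le> 0"
proof (rule ccontr)
  assume "\<not> \<alpha> \<le> 0"
  then have \<alpha>: "0 < \<alpha>" by simp
  define s where "s = max s0 ((\<gamma> - a) / \<alpha> + 1)"
  have "\<alpha> * ((\<gamma> - a) / \<alpha> + 1) \<le> \<alpha> * s" using \<alpha> by (intro mult_left_mono) (auto simp: s_def)
  moreover have "\<alpha> * ((\<gamma> - a) / \<alpha> + 1) = \<gamma> - a + \<alpha>" using \<alpha> by (simp add: distrib_left)
  moreover have "a + \<alpha> * s \<le> \<gamma>" by (rule assms) (simp add: s_def)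
  ultimately show False using \<alpha> by linarith
qed

lemma nonvertical_hyperplane_minorant:
  assumes "\<forall>(y, s)\<in>epigraph h. dual_apply \<phi> y + \<alpha> * s \<le> \<gamma>" and "\<alpha> = - a" "0 < a"
  shows "((1 / a) *\<^sub>R \<phi>, \<gamma> / a) \<in> epigraph (conjugate h)"
proof -
  have "dual_apply \<phi> y / a \<le> \<gamma> / a + s" if "(y, s) \<in> epigraph h" for y s
  proof -
    have "dual_apply \<phi> y \<le> \<gamma> + a * s" using assms(1,2) that by auto
    then show ?thesis using assms(3) by (simp add: field_simps)
  qed
  then show ?thesis by (auto simp: mem_epigraph_conjugate scaleR_dual.rep_eq)
qed

lemma proper_obtain_real:
  assumes "proper_fun h"
  obtains y s where "h y = ereal s"
proof -
  obtain y where "h y < \<infinity>" "h y \<noteq> - \<infinity>"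
    using assms by (auto simp: proper_fun_def domain_def)
  then show ?thesis using that by (cases "h y") auto
qed

text \<open>A point
  below the graph is separated from the epigraph; a nonvertical hyperplane is already an affine
  minorant. A vertical one, \<open>\<phi> y \<le> \<gamma>\<close> on the domain with \<open>\<phi> x > \<gamma>\<close>, is added with a large factor to
  some affine minorant, whose value at \<open>x\<close> is thereby driven to infinity. Such a first minorant
  arises from separating a point below the graph over the domain, where no vertical hyperplane can
  separate.\<close>

theorem fenchel_moreau:
  fixes h :: "'a::locally_convex_space \<Rightarrow> ereal"
  assumes h: "h \<in> lsc_proper_convex"
    and minorants: "\<And>\<phi> s. (\<phi>, s) \<in> epigraph (conjugate h) \<Longrightarrow> dual_apply \<phi> x \<le> s + \<beta>"
  shows "h x \<le> ereal \<beta>"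
proof (rule ccontr)
  assume "\<not> h x \<le> ereal \<beta>"
  then have out: "(x, \<beta>) \<notin> epigraph h" by (simp add: epigraph_def)
  have C: "convex (epigraph h)" "closure (epigraph h) = epigraph h"
    using h by (auto simp: lsc_proper_convex_def convex_fun_def lsc_closed_epigraph)
  obtain y0 s0 where y0: "h y0 = ereal s0"
    using h proper_obtain_real by (auto simp: lsc_proper_convex_def)
  then have y0s: "(y0, s) \<in> epigraph h" if "s0 \<le> s" for s using that by (simp add: epigraph_def)
  have slope: "\<alpha> \<le> 0" if "\<forall>(y, s)\<in>epigraph h. dual_apply \<phi> y + \<alpha> * s \<le> \<gamma>" for \<phi> \<alpha> \<gamma>
    using that y0s by (intro upward_slope_nonpos[of s0 "dual_apply \<phi> y0"]) auto
  have "(y0, s0 - 1) \<notin> closure (epigraph h)" unfolding C(2) using y0 by (simp add: epigraph_def)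
  from separation_primal[OF C(1) this] obtain \<phi>1 \<alpha>1 \<gamma>1 where
    1: "\<forall>(y, s)\<in>epigraph h. dual_apply \<phi>1 y + \<alpha>1 * s \<le> \<gamma>1"
       "\<gamma>1 < dual_apply \<phi>1 y0 + \<alpha>1 * (s0 - 1)" by blast
  have "dual_apply \<phi>1 y0 + \<alpha>1 * s0 \<le> \<gamma>1" using 1(1) y0s[of s0] by auto
  then have "\<alpha>1 \<noteq> 0" using 1(2) by auto
  with slope[OF 1(1)] have "0 < - \<alpha>1" by simp
  from nonvertical_hyperplane_minorant[OF 1(1) _ this]
  obtain \<eta> q where \<eta>: "(\<eta>, q) \<in> epigraph (conjugate h)" by auto
  have "(x, \<beta>) \<notin> closure (epigraph h)" unfolding C(2) by (rule out)
  from separation_primal[OF C(1) this] obtain \<phi> \<alpha> \<gamma> where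
    2: "\<forall>(y, s)\<in>epigraph h. dual_apply \<phi> y + \<alpha> * s \<le> \<gamma>"
       "\<gamma> < dual_apply \<phi> x + \<alpha> * \<beta>" by blast
  show False
  proof (cases "\<alpha> < 0")
    case True
    define a where "a = - \<alpha>"
    have a: "\<alpha> = - a" "0 < a" using True by (auto simp: a_def)
    from minorants[OF nonvertical_hyperplane_minorant[OF 2(1) a]]
    have "dual_apply \<phi> x / a \<le> \<gamma> / a + \<beta>" by (simp add: scaleR_dual.rep_eq)
    then show False using 2(2) a by (simp add: field_simps)
  next
    case False
    then have \<alpha>: "\<alpha> = 0" using slope[OF 2(1)] by simp
    have tilt: "dual_apply \<eta> x + t * dual_apply \<phi> x \<le> q + t * \<gamma> + \<beta>" if t: "0 \<le> t" for t
    proof -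
      have "dual_apply \<eta> y + t * dual_apply \<phi> y \<le> q + t * \<gamma> + s" if "(y, s) \<in> epigraph h" for y s
      proof -
        have "dual_apply \<phi> y \<le> \<gamma>" using 2(1) that \<alpha> by auto
        then have "t * dual_apply \<phi> y \<le> t * \<gamma>" using t by (rule mult_left_mono)
        moreover have "dual_apply \<eta> y \<le> q + s" using \<eta> that by (auto simp: mem_epigraph_conjugate)
        ultimately show ?thesis by simp
      qed
      then have "(\<eta> + t *\<^sub>R \<phi>, q + t * \<gamma>) \<in> epigraph (conjugate h)"
        by (auto simp: mem_epigraph_conjugate plus_dual.rep_eq scaleR_dual.rep_eq)
      from minorants[OF this] show ?thesis by (simp add: plus_dual.rep_eq scaleR_dual.rep_eq)
    qed
    have "dual_apply \<phi> x - \<gamma> \<le> 0"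
    proof (rule upward_slope_nonpos)
      show "dual_apply \<eta> x + (dual_apply \<phi> x - \<gamma>) * t \<le> q + \<beta>" if "0 \<le> t" for t
        using tilt[OF that] by (simp add: algebra_simps)
    qed
    then show False using 2(2) \<alpha> by simp
  qed
qed

lemma conjugate_antimono:
  assumes "\<And>x. l x \<le> h x"
  shows "conjugate h \<phi> \<le> conjugate l \<phi>"
  unfolding conjugate_def by (rule SUP_mono', rule ereal_minus_mono[OF order_refl assms])

text \<open>Suppose a point
  \<open>(\<phi>, r)\<close> of the left-hand side lies outside the closed convex hull. Weak* separation yields
  \<open>(x, \<alpha>)\<close> with \<open>\<psi> x + \<alpha> s \<le> \<gamma> < \<phi> x + \<alpha> r\<close> for all \<open>(\<psi>, s)\<close> of the hull. If \<open>\<alpha> = - a < 0\<close>,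
  Fenchel--Moreau applied to every \<open>l \<in> F\<close> turns this into \<open>h (x / a) \<le> \<gamma> / a\<close> for the supremum
  \<open>h\<close>, against \<open>h* \<phi> \<le> r\<close>. If \<open>\<alpha> = 0\<close>, the direction \<open>x\<close> is combined with the base point \<open>x1\<close>: along
  the ray \<open>x1 + t x\<close> the function \<open>h\<close> grows at most with slope \<open>\<gamma>\<close>, but by \<open>h* \<phi> \<le> r\<close> at least with
  slope \<open>\<phi> x > \<gamma>\<close>. This is where the finiteness of \<open>h\<close> at some point enters.\<close>

lemma conjugate_Sup:
  fixes F :: "('a::locally_convex_space \<Rightarrow> ereal) set"
  assumes F: "F \<subseteq> lsc_proper_convex" "F \<noteq> {}"
    and x1: "(SUP l\<in>F. l x1) < \<infinity>"
  shows "epigraph (conjugate (\<lambda>x. SUP l\<in>F. l x))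
    = closure (convex hull (\<Union>l\<in>F. epigraph (conjugate l)))"
    (is "epigraph (conjugate ?h) = closure (convex hull ?A)")
proof
  have upper: "l x \<le> ?h x" if "l \<in> F" for l x
    using SUP_upper[OF that, of "\<lambda>l. l x"] .
  have "epigraph (conjugate l) \<subseteq> epigraph (conjugate ?h)" if "l \<in> F" for l
  proof -
    have "conjugate ?h \<phi> \<le> conjugate l \<phi>" for \<phi>
      by (intro conjugate_antimono upper that)
    then show ?thesis by (auto simp: epigraph_def intro: order_trans)
  qed
  then have "?A \<subseteq> epigraph (conjugate ?h)" by blast
  then show "closure (convex hull ?A) \<subseteq> epigraph (conjugate ?h)"
    by (intro closure_minimal hull_minimal convex_epigraph_conjugate closed_epigraph_conjugate)
next
  have upper: "l x \<le> ?h x" if "l \<in> F" for l x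
    using SUP_upper[OF that, of "\<lambda>l. l x"] .
  have above: "?h x \<le> ereal \<beta>"
    if A: "\<And>\<phi> s. (\<phi>, s) \<in> ?A \<Longrightarrow> dual_apply \<phi> x \<le> s + \<beta>" for x \<beta>
  proof (rule SUP_least)
    fix l assume "l \<in> F"
    then show "l x \<le> ereal \<beta>" using F(1) A by (intro fenchel_moreau) blast+
  qed
  have not_MInf: "?h x \<noteq> - \<infinity>" for x
  proof -
    obtain l where "l \<in> F" using F(2) by blast
    then have "l \<in> lsc_proper_convex" "l x \<le> ?h x" using F(1) upper by auto
    then show ?thesis by (auto simp: lsc_proper_convex_def proper_fun_def)
  qed
  obtain \<beta>1 where \<beta>1: "?h x1 = ereal \<beta>1" using x1 not_MInf[of x1] by (cases "?h x1") auto
  have A_x1: "dual_apply \<phi> x1 \<le> s + \<beta>1" if "(\<phi>, s) \<in> ?A" for \<phi> s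
  proof -
    obtain l where l: "l \<in> F" "(\<phi>, s) \<in> epigraph (conjugate l)" using \<open>(\<phi>, s) \<in> ?A\<close> by blast
    have "l x1 \<le> ?h x1" using l(1) by (rule upper)
    then have "(x1, \<beta>1) \<in> epigraph l" using \<beta>1 by (simp add: epigraph_def)
    then show ?thesis using l(2) by (auto simp: mem_epigraph_conjugate)
  qed
  \<comment> \<open>With no conjugate inequality at all, every real would bound \<open>?h x1\<close>.\<close>
  obtain \<eta> q where \<eta>: "(\<eta>, q) \<in> ?A"
  proof (rule ccontr)
    assume "\<not> thesis"
    then have "?A = {}" using that by auto
    then have "?h x1 \<le> ereal (\<beta>1 - 1)" by (intro above) blast
    then show False using \<beta>1 by simp
  qed
  show "epigraph (conjugate ?h) \<subseteq> closure (convex hull ?A)"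
  proof (clarify, rule ccontr)
    fix \<phi> r
    assume mem: "(\<phi>, r) \<in> epigraph (conjugate ?h)" and out: "(\<phi>, r) \<notin> closure (convex hull ?A)"
    \<comment> \<open>A bound at \<open>x\<close> common to \<open>?A\<close> passes to \<open>?h x\<close>, hence to the point \<open>(\<phi>, r)\<close>.\<close>
    have in_h: "dual_apply \<phi> x \<le> r + \<beta>"
      if A: "\<And>\<psi> s. (\<psi>, s) \<in> ?A \<Longrightarrow> dual_apply \<psi> x \<le> s + \<beta>" for x \<beta>
    proof -
      have "(x, \<beta>) \<in> epigraph ?h" using above[OF A] by (simp add: epigraph_def)
      with mem[unfolded mem_epigraph_conjugate] show ?thesis by blast
    qed
    from separation_weak_star[OF convex_convex_hull out] obtain x \<alpha> \<gamma> where
      sep': "\<forall>(\<psi>, s)\<in>convex hull ?A. dual_apply \<psi> x + \<alpha> * s \<le> \<gamma>" and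
      gap: "\<gamma> < dual_apply \<phi> x + \<alpha> * r" by blast
    have sep: "dual_apply \<psi> x + \<alpha> * s \<le> \<gamma>" if "(\<psi>, s) \<in> ?A" for \<psi> s
    proof -
      have "(\<psi>, s) \<in> convex hull ?A" using that by (rule hull_inc)
      with sep' show ?thesis by blast
    qed
    have "\<alpha> \<le> 0"
    proof (rule upward_slope_nonpos)
      fix s assume "q \<le> s"
      then have "(\<eta>, s) \<in> ?A" using \<eta> by (auto intro: epigraph_mono)
      then show "dual_apply \<eta> x + \<alpha> * s \<le> \<gamma>" by (rule sep)
    qed
    show False
    proof (cases "\<alpha> = 0")
      case True
      have "(dual_apply \<phi> x - \<gamma>) * t + dual_apply \<phi> x1 \<le> r + \<beta>1" if t: "0 \<le> t" for t
      proof -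
        have "dual_apply \<phi> (x1 + t *\<^sub>R x) \<le> r + (\<beta>1 + t * \<gamma>)"
        proof (rule in_h)
          fix \<psi> s assume A: "(\<psi>, s) \<in> ?A"
          have "t * dual_apply \<psi> x \<le> t * \<gamma>" using sep[OF A] True t by (intro mult_left_mono) auto
          then show "dual_apply \<psi> (x1 + t *\<^sub>R x) \<le> s + (\<beta>1 + t * \<gamma>)"
            using A_x1[OF A]
            by (simp add: linear_add[OF dual_apply_linear] linear_scale[OF dual_apply_linear])
        qed
        then show ?thesis
          by (simp add: linear_add[OF dual_apply_linear] linear_scale[OF dual_apply_linear] algebra_simps)
      qed
      then have "dual_apply \<phi> x - \<gamma> \<le> 0"
        by (intro upward_slope_nonpos[of 0 "dual_apply \<phi> x1"]) (simp add: add.commute)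
      then show False using gap True by simp
    next
      case False
      define a where "a = - \<alpha>"
      have a: "\<alpha> = - a" "0 < a" using False \<open>\<alpha> \<le> 0\<close> by (auto simp: a_def)
      have "dual_apply \<phi> ((1 / a) *\<^sub>R x) \<le> r + \<gamma> / a"
      proof (rule in_h)
        fix \<psi> s assume "(\<psi>, s) \<in> ?A"
        from sep[OF this] show "dual_apply \<psi> ((1 / a) *\<^sub>R x) \<le> s + \<gamma> / a"
          unfolding linear_scale[OF dual_apply_linear] using a by (simp add: field_simps)
      qed
      then show False
        unfolding linear_scale[OF dual_apply_linear] using gap a by (simp add: field_simps)
    qed
  qed
qed


section \<open>Lagrangians of the constraint system\<close>

text \<open>Unlike \<^term>\<open>lsc_proper_convex\<close>, this class is closed under sums without any condition on
  the domains; properness of a Lagrangian comes from the feasible point instead.\<close>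

definition lsc_convex :: "('a::locally_convex_space \<Rightarrow> ereal) \<Rightarrow> bool" where
  "lsc_convex h \<longleftrightarrow> lsc_fun h \<and> convex_fun h \<and> (\<forall>x. h x \<noteq> - \<infinity>)"

lemma lsc_proper_convex_iff: "h \<in> lsc_proper_convex \<longleftrightarrow> lsc_convex h \<and> (\<exists>x. h x < \<infinity>)"
  by (auto simp: lsc_proper_convex_def lsc_convex_def proper_fun_def domain_def)

lemma lsc_convex_zero: "lsc_convex (\<lambda>x. 0)"
proof -
  have "epigraph (\<lambda>x::'a. 0) = UNIV \<times> {0..}" by (auto simp: epigraph_def)
  then show ?thesis
    by (auto simp: lsc_convex_def lsc_fun_def convex_fun_def intro!: convex_Times convex_real_interval)
qed

text \<open>Lower semicontinuity of a sum needs a bound below the sum to be distributed to the summands,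
  also when one of them is infinite.\<close>

lemma ereal_less_add_split:
  fixes a b c :: ereal
  assumes "c < a + b" "a \<noteq> - \<infinity>" "b \<noteq> - \<infinity>"
  shows "\<exists>p q. ereal p < a \<and> ereal q < b \<and> c \<le> ereal p + ereal q"
proof -
  have below: "\<exists>p. ereal p < u" if "u \<noteq> - \<infinity>" for u
    using that by (cases u) (auto intro: lt_ex)
  show ?thesis
  proof (cases c)
    case MInf
    then show ?thesis using below[OF assms(2)] below[OF assms(3)] by auto
  next
    case PInf
    then show ?thesis using assms(1) by simp
  next
    case c: (real m)
    show ?thesis
    proof (cases a)
      case a: (real u)
      show ?thesis
      proof (cases b)
        case b: (real v)
        have "m < u + v" using assms(1) a b c by simp
        then show ?thesis using a b c
          by (intro exI[of _ "u - (u + v - m) / 2"] exI[of _ "v - (u + v - m) / 2"])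
             (simp add: field_simps)
      next
        case PInf
        then show ?thesis using a c by (intro exI[of _ "u - 1"] exI[of _ "m - u + 1"]) simp
      qed (use assms in auto)
    next
      case PInf
      obtain q where "ereal q < b" using below[OF assms(3)] by blast
      then show ?thesis using PInf c by (intro exI[of _ "m - q"] exI[of _ q]) simp
    qed (use assms in auto)
  qed
qed

lemma lsc_convex_add:
  assumes h: "lsc_convex h" and k: "lsc_convex k"
  shows "lsc_convex (\<lambda>x. h x + k x)"
proof -
  have fin: "h x \<noteq> - \<infinity>" "k x \<noteq> - \<infinity>" for x using h k by (auto simp: lsc_convex_def)
  have "\<forall>\<^sub>F y in nhds x. c < h y + k y" if less: "c < h x + k x" for x c
  proof -
    obtain p q where pq: "ereal p < h x" "ereal q < k x" "c \<le> ereal p + ereal q"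
      using ereal_less_add_split[OF less fin] by blast
    have "\<forall>\<^sub>F y in nhds x. ereal p < h y" "\<forall>\<^sub>F y in nhds x. ereal q < k y"
      using h k pq(1,2) by (auto simp: lsc_convex_def lsc_fun_def)
    then show ?thesis
    proof eventually_elim
      case (elim y)
      show ?case by (rule le_less_trans[OF pq(3) ereal_add_strict_mono2[OF elim]])
    qed
  qed
  then have "lsc_fun (\<lambda>x. h x + k x)" by (simp add: lsc_fun_def)
  moreover have "convex (epigraph (\<lambda>x. h x + k x))"
  proof (rule convexI)
    \<comment> \<open>The epigraph of a sum consists of the fibrewise sums of the two epigraphs.\<close>
    have split: "\<exists>s. (x, s) \<in> epigraph h \<and> (x, r - s) \<in> epigraph k"
      if "(x, r) \<in> epigraph (\<lambda>x. h x + k x)" for x r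
      using that fin[of x] unfolding epigraph_def
      by (cases "h x"; cases "k x") (auto intro!: exI[of _ "real_of_ereal (h x)"])
    fix z w :: "'a \<times> real" and u v :: real
    assume z: "z \<in> epigraph (\<lambda>x. h x + k x)" and w: "w \<in> epigraph (\<lambda>x. h x + k x)"
      and uv: "0 \<le> u" "0 \<le> v" "u + v = 1"
    obtain x r y q where zw: "z = (x, r)" "w = (y, q)" by (cases z, cases w)
    obtain s where s: "(x, s) \<in> epigraph h" "(x, r - s) \<in> epigraph k" using split z zw by blast
    obtain t where t: "(y, t) \<in> epigraph h" "(y, q - t) \<in> epigraph k" using split w zw by blast
    have ch: "convex (epigraph h)" "convex (epigraph k)"
      using h k by (auto simp: lsc_convex_def convex_fun_def)
    have "u *\<^sub>R (x, s) + v *\<^sub>R (y, t) \<in> epigraph h"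
      by (rule convexD[OF ch(1) s(1) t(1) uv])
    moreover have "u *\<^sub>R (x, r - s) + v *\<^sub>R (y, q - t) \<in> epigraph k"
      by (rule convexD[OF ch(2) s(2) t(2) uv])
    ultimately have "h (u *\<^sub>R x + v *\<^sub>R y) + k (u *\<^sub>R x + v *\<^sub>R y)
        \<le> ereal (u * s + v * t) + ereal (u * (r - s) + v * (q - t))"
      by (intro add_mono) (auto simp: epigraph_def)
    also have "\<dots> = ereal (u * r + v * q)" by (simp add: algebra_simps)
    finally show "u *\<^sub>R z + v *\<^sub>R w \<in> epigraph (\<lambda>x. h x + k x)"
      by (simp add: zw epigraph_def)
  qed
  moreover have "h x + k x \<noteq> - \<infinity>" for x using fin[of x] by (cases "h x"; cases "k x") auto
  ultimately show ?thesis by (simp add: lsc_convex_def convex_fun_def)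
qed

lemma lsc_convex_scale:
  assumes h: "lsc_convex h" and m: "0 \<le> m"
  shows "lsc_convex (\<lambda>x. ereal m * h x)"
proof (cases "m = 0")
  case True
  then show ?thesis using lsc_convex_zero by (simp flip: zero_ereal_def)
next
  case False
  with m have m: "0 < m" by simp
  \<comment> \<open>A positive factor only rescales strict lower bounds and the epigraph.\<close>
  have less: "c < ereal m * u \<longleftrightarrow> c / ereal m < u" for c u
    using m ereal_divide_less_pos[of "ereal m" c u] by (simp add: mult.commute)
  have le: "ereal m * u \<le> ereal r \<longleftrightarrow> u \<le> ereal (r / m)" for u r
    using m by (cases u) (auto simp: field_simps)
  have "lsc_fun (\<lambda>x. ereal m * h x)"
    using h by (simp add: lsc_fun_def lsc_convex_def less)
  moreover have "convex (epigraph (\<lambda>x. ereal m * h x))"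
  proof (rule convexI)
    fix z w :: "'a \<times> real" and u v :: real
    assume z: "z \<in> epigraph (\<lambda>x. ereal m * h x)" and w: "w \<in> epigraph (\<lambda>x. ereal m * h x)"
      and uv: "0 \<le> u" "0 \<le> v" "u + v = 1"
    obtain x r y q where zw: "z = (x, r)" "w = (y, q)" by (cases z, cases w)
    have in_h: "(x, r / m) \<in> epigraph h" "(y, q / m) \<in> epigraph h"
      using z w zw by (simp_all add: epigraph_def le)
    have "convex (epigraph h)" using h by (simp add: lsc_convex_def convex_fun_def)
    from convexD[OF this in_h uv]
    show "u *\<^sub>R z + v *\<^sub>R w \<in> epigraph (\<lambda>x. ereal m * h x)"
      by (simp add: zw epigraph_def le add_divide_distrib)
  qed
  moreover have "ereal m * h x \<noteq> - \<infinity>" for x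
    using h m by (cases "h x") (auto simp: lsc_convex_def)
  ultimately show ?thesis by (simp add: lsc_convex_def convex_fun_def)
qed

lemma lsc_convex_sum:
  assumes "finite I" "\<And>i. i \<in> I \<Longrightarrow> lsc_convex (h i)"
  shows "lsc_convex (\<lambda>x. \<Sum>i\<in>I. h i x)"
  using assms by (induction I rule: finite_induct) (auto intro: lsc_convex_zero lsc_convex_add)

lemma lsc_convex_lagrangian:
  assumes "lsc_convex f" "finite H" "\<And>t. t \<in> H \<Longrightarrow> lsc_convex (g t)" "\<And>t. t \<in> H \<Longrightarrow> 0 \<le> \<mu> t"
  shows "lsc_convex (lagrangian f g H \<mu>)"
  unfolding lagrangian_def using assms
  by (intro lsc_convex_add lsc_convex_sum lsc_convex_scale)

definition lagrangians ::
    "('b \<Rightarrow> ereal) \<Rightarrow> ('t \<Rightarrow> 'b \<Rightarrow> ereal) \<Rightarrow> 't set set \<Rightarrow> ('b \<Rightarrow> ereal) set" where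
  "lagrangians f g \<H> = {lagrangian f g H \<mu> | H \<mu>. H \<in> \<H> \<and> \<mu> \<in> H \<rightarrow>\<^sub>E {0..}}"

lemma A_set_eq: "A_set f g \<H> = (\<Union>l\<in>lagrangians f g \<H>. epigraph (conjugate l))"
  by (auto simp: A_set_def lagrangians_def)

lemma dual_values_eq: "dual_values f g \<H> \<phi> = (\<lambda>l. conjugate l \<phi>) ` lagrangians f g \<H>"
  by (auto simp: dual_values_def lagrangians_def)

lemma lagrangians_nonempty:
  assumes "\<H> \<noteq> {}"
  shows "lagrangians f g \<H> \<noteq> {}"
proof -
  obtain H where "H \<in> \<H>" using assms by blast
  then have "lagrangian f g H (restrict (\<lambda>_. 0) H) \<in> lagrangians f g \<H>"
    unfolding lagrangians_def by (auto intro!: exI)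
  then show ?thesis by blast
qed

lemma lagrangian_le_constrained:
  assumes "l \<in> lagrangians f g \<H>" "\<Union>\<H> = T"
  shows "l x \<le> f x + indicator_fun (feasible_set T g) x"
proof (cases "x \<in> feasible_set T g")
  case True
  obtain H \<mu> where l: "l = lagrangian f g H \<mu>" "H \<in> \<H>" "\<mu> \<in> H \<rightarrow>\<^sub>E {0..}"
    using assms(1) by (auto simp: lagrangians_def)
  have "ereal (\<mu> t) * g t x \<le> 0" if "t \<in> H" for t
  proof -
    have "g t x \<le> 0" using True that l(2) assms(2) by (auto simp: feasible_set_def)
    moreover have "0 \<le> \<mu> t" using l(3) that by (auto simp: PiE_iff)
    ultimately show ?thesis by (simp add: ereal_zero_le_0_iff ereal_mult_le_0_iff)
  qed
  then have "l x \<le> f x + 0" unfolding l(1) lagrangian_def by (intro add_left_mono sum_nonpos)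
  then show ?thesis using True by (simp add: indicator_fun_def)
qed (simp add: indicator_fun_def)

text \<open>At an infeasible point some constraint \<open>t\<close> is violated; the covering property puts \<open>t\<close> in a
  member of the family, and letting its multiplier grow, with the others zero, drives the
  Lagrangian to infinity.\<close>

lemma SUP_lagrangians:
  assumes f: "f x \<noteq> - \<infinity>"
    and \<H>: "\<H> \<noteq> {}" "\<H> \<subseteq> finite_nonempty_subsets T" "\<Union>\<H> = T"
  shows "(SUP l\<in>lagrangians f g \<H>. l x) = f x + indicator_fun (feasible_set T g) x"
    (is "?S = ?h")
proof (rule antisym)
  show "?S \<le> ?h" by (intro SUP_least lagrangian_le_constrained[OF _ \<H>(3)])
  show "?h \<le> ?S"
  proof (rule ereal_le_real)
    fix \<beta> assume S: "?S \<le> ereal \<beta>"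
    have bound: "f x + (\<Sum>t\<in>H. ereal (\<mu> t) * g t x) \<le> ereal \<beta>"
      if "H \<in> \<H>" "\<And>t. t \<in> H \<Longrightarrow> 0 \<le> \<mu> t" for H \<mu>
    proof -
      have "lagrangian f g H (restrict \<mu> H) \<in> lagrangians f g \<H>"
        unfolding lagrangians_def mem_Collect_eq using that by (intro exI conjI refl) auto
      then have "lagrangian f g H (restrict \<mu> H) x \<le> ?S"
        by (rule SUP_upper)
      with S show ?thesis by (simp add: lagrangian_def)
    qed
    obtain H0 where "H0 \<in> \<H>" using \<H>(1) by blast
    from bound[OF this, of "\<lambda>_. 0"] have f_le: "f x \<le> ereal \<beta>" by (simp flip: zero_ereal_def)
    then obtain a where a: "f x = ereal a" using f by (cases "f x") auto
    have "x \<in> feasible_set T g"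
    proof (rule ccontr)
      assume "x \<notin> feasible_set T g"
      then obtain t where t: "t \<in> T" "0 < g t x" by (auto simp: feasible_set_def not_le)
      obtain H where H: "t \<in> H" "H \<in> \<H>" using t(1) \<H>(3) by blast
      have finH: "finite H" using H(2) \<H>(2) by (auto simp: finite_nonempty_subsets_def)
      have single: "ereal a + ereal m * g t x \<le> ereal \<beta>" if "0 \<le> m" for m
      proof -
        have "(\<Sum>s\<in>H. ereal (if s = t then m else 0) * g s x)
            = (\<Sum>s\<in>H. if s = t then ereal m * g t x else 0)"
          by (intro sum.cong) (auto simp flip: zero_ereal_def)
        also have "\<dots> = ereal m * g t x" using finH H(1) by simp
        finally show ?thesis using bound[OF H(2), of "\<lambda>s. if s = t then m else 0"] that a by simp
      qed
      show False
      proof (cases "g t x")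
        case (real b)
        then have "b \<le> 0"
          using single by (intro upward_slope_nonpos[of 0 a b \<beta>]) (simp add: mult.commute)
        then show False using t(2) real by simp
      next
        case PInf
        then show False using single[of 1] by simp
      qed (use t in auto)
    qed
    then show "?h \<le> ereal \<beta>" using f_le by (simp add: indicator_fun_def)
  qed
qed

text \<open>The constrained objective is the supremum of the Lagrangians, all of them lower semicontinuous,
  proper and convex, so its conjugate is generated by theirs.\<close>

theorem closure_hull_A_set:
  assumes f: "f \<in> lsc_proper_convex" and g: "\<And>t. t \<in> T \<Longrightarrow> g t \<in> lsc_proper_convex"
    and \<H>: "\<H> \<noteq> {}" "\<H> \<subseteq> finite_nonempty_subsets T" "\<Union>\<H> = T"
    and feasible: "feasible_set T g \<inter> domain f \<noteq> {}"
  shows "closure (convex hull A_set f g \<H>)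
    = epigraph (conjugate (\<lambda>x. f x + indicator_fun (feasible_set T g) x))"
proof -
  have lc: "lsc_convex f" "\<And>t. t \<in> T \<Longrightarrow> lsc_convex (g t)"
    using f g by (auto simp: lsc_proper_convex_iff)
  have sup: "(SUP l\<in>lagrangians f g \<H>. l x) = f x + indicator_fun (feasible_set T g) x" for x
    using lc by (intro SUP_lagrangians \<H>) (auto simp: lsc_convex_def)
  obtain x1 where x1: "x1 \<in> feasible_set T g" "f x1 < \<infinity>"
    using feasible by (auto simp: domain_def)
  have "lagrangians f g \<H> \<subseteq> lsc_proper_convex"
  proof
    fix l assume l: "l \<in> lagrangians f g \<H>"
    then obtain H \<mu> where H: "l = lagrangian f g H \<mu>" "H \<in> \<H>" "\<mu> \<in> H \<rightarrow>\<^sub>E {0..}"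
      by (auto simp: lagrangians_def)
    have "lsc_convex l" unfolding H(1)
      using H(2,3) \<H>(2) lc
      by (intro lsc_convex_lagrangian) (auto simp: finite_nonempty_subsets_def PiE_iff)
    moreover have "l x1 < \<infinity>"
      using lagrangian_le_constrained[OF l \<H>(3), of x1] x1 by (auto simp: indicator_fun_def)
    ultimately show "l \<in> lsc_proper_convex" by (auto simp: lsc_proper_convex_iff)
  qed
  from conjugate_Sup[OF this lagrangians_nonempty[OF \<H>(1)], of x1] x1
  show ?thesis by (simp add: sup A_set_eq indicator_fun_def)
qed

section \<open>Strong duality\<close>

lemma A_set_subset_epigraph:
  assumes "\<Union>\<H> = T"
  shows "A_set f g \<H> \<subseteq> epigraph (conjugate (\<lambda>x. f x + indicator_fun (feasible_set T g) x))"
proof -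
  have "conjugate (\<lambda>x. f x + indicator_fun (feasible_set T g) x) \<phi> \<le> conjugate l \<phi>"
    if "l \<in> lagrangians f g \<H>" for l \<phi>
    by (intro conjugate_antimono lagrangian_le_constrained[OF that assms])
  then show ?thesis unfolding A_set_eq by (auto simp: epigraph_def intro: order_trans)
qed

text \<open>An attained dual value equal to the primal one places every point of the fibre over \<open>\<phi>\<close> in the
  epigraph of the conjugate of one and the same Lagrangian, whether that value is finite or not.\<close>

lemma strong_duality_attained:
  assumes "strong_duality_at T f g \<H> \<phi>"
  shows "epigraph (conjugate (\<lambda>x. f x + indicator_fun (feasible_set T g) x)) \<inter> ({\<phi>} \<times> UNIV)
    \<subseteq> A_set f g \<H>"
proof -
  let ?h = "\<lambda>x. f x + indicator_fun (feasible_set T g) x"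
  have "conjugate ?h \<phi> \<in> (\<lambda>l. conjugate l \<phi>) ` lagrangians f g \<H>"
    using assms unfolding strong_duality_at_def dual_values_eq by simp
  then obtain l where "l \<in> lagrangians f g \<H>" "conjugate ?h \<phi> = conjugate l \<phi>" by blast
  then show ?thesis unfolding A_set_eq by (auto simp: epigraph_def)
qed

text \<open>The value \<open>- \<infinity>\<close> is excluded because the infimum could then be approached without being
  attained. The value \<open>\<infinity>\<close> is attained by every Lagrangian, by weak duality.\<close>

lemma strong_duality_if_attained:
  assumes "\<Union>\<H> = T" "\<H> \<noteq> {}"
    and bot: "conjugate (\<lambda>x. f x + indicator_fun (feasible_set T g) x) \<phi> \<noteq> - \<infinity>"
    and sub: "epigraph (conjugate (\<lambda>x. f x + indicator_fun (feasible_set T g) x)) \<inter> ({\<phi>} \<times> UNIV)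
      \<subseteq> A_set f g \<H>"
  shows "strong_duality_at T f g \<H> \<phi>"
proof -
  let ?h = "\<lambda>x. f x + indicator_fun (feasible_set T g) x"
  let ?D = "(\<lambda>l. conjugate l \<phi>) ` lagrangians f g \<H>"
  have weak: "conjugate ?h \<phi> \<le> conjugate l \<phi>" if "l \<in> lagrangians f g \<H>" for l
    by (intro conjugate_antimono lagrangian_le_constrained[OF that assms(1)])
  obtain l where l: "l \<in> lagrangians f g \<H>" "conjugate l \<phi> \<le> conjugate ?h \<phi>"
  proof (cases "conjugate ?h \<phi>")
    case (real r)
    then have "(\<phi>, r) \<in> A_set f g \<H>" by (intro subsetD[OF sub]) (simp add: epigraph_def)
    then obtain l where "l \<in> lagrangians f g \<H>" "(\<phi>, r) \<in> epigraph (conjugate l)"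
      unfolding A_set_eq by blast
    then show ?thesis using that real by (simp add: epigraph_def)
  next
    case PInf
    obtain l where "l \<in> lagrangians f g \<H>" using lagrangians_nonempty[OF assms(2)] by blast
    then show ?thesis using that PInf by simp
  qed (use bot in simp)
  have eq: "conjugate l \<phi> = conjugate ?h \<phi>" using l weak by (intro antisym) auto
  have "Inf ?D = conjugate ?h \<phi>"
    unfolding eq[symmetric] using l weak by (intro antisym INF_lower INF_greatest) (auto simp: eq)
  moreover have "conjugate ?h \<phi> \<in> ?D" using l(1) eq by (metis imageI)
  ultimately show ?thesis unfolding strong_duality_at_def dual_values_eq by simp
qed

theorem theorem5p1:
  fixes T :: "'t set"
    and f :: "'a::locally_convex_space \<Rightarrow> ereal"
    and g :: "'t \<Rightarrow> 'a \<Rightarrow> ereal"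
    and \<H> :: "'t set set"
  assumes "infinite T"
    and "proper_fun f" and "convex_fun f"
    and "\<And>t. t \<in> T \<Longrightarrow> proper_fun (g t)" and "\<And>t. t \<in> T \<Longrightarrow> convex_fun (g t)"
    and "\<H> \<noteq> {}" and "\<H> \<subseteq> finite_nonempty_subsets T" and "\<Union>\<H> = T"
  shows
    "(\<forall>\<phi> :: 'a dual. strong_duality_at T f g \<H> \<phi> \<longrightarrow>
        closed_convex_regarding (A_set f g \<H>) ({\<phi>} \<times> UNIV)) \<and>
     (f \<in> lsc_proper_convex \<and> (\<forall>t\<in>T. g t \<in> lsc_proper_convex) \<and>
        feasible_set T g \<inter> domain f \<noteq> {} \<longrightarrow>
        (\<forall>\<phi> :: 'a dual. strong_duality_at T f g \<H> \<phi> \<longleftrightarrow>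
           closed_convex_regarding (A_set f g \<H>) ({\<phi>} \<times> UNIV)) \<and>
        (stable_strong_duality T f g \<H> \<longleftrightarrow>
           closed (A_set f g \<H>) \<and> convex (A_set f g \<H>)))"
proof -
  let ?h = "\<lambda>x. f x + indicator_fun (feasible_set T g) x"
  let ?A = "A_set f g \<H>"
  have hull: "closure (convex hull ?A) \<subseteq> epigraph (conjugate ?h)"
    by (intro closure_minimal hull_minimal convex_epigraph_conjugate closed_epigraph_conjugate
        A_set_subset_epigraph assms)
  have A_closure: "?A \<subseteq> closure (convex hull ?A)"
    using hull_subset closure_subset by (rule subset_trans)
  have forward: "closed_convex_regarding ?A ({\<phi>} \<times> UNIV)"
    if "strong_duality_at T f g \<H> \<phi>" for \<phi>
    using strong_duality_attained[OF that] hull A_closure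
    unfolding closed_convex_regarding_def by blast
  have lsc_case: "(\<forall>\<phi>. strong_duality_at T f g \<H> \<phi> \<longleftrightarrow> closed_convex_regarding ?A ({\<phi>} \<times> UNIV)) \<and>
      (stable_strong_duality T f g \<H> \<longleftrightarrow> closed ?A \<and> convex ?A)"
    if lsc: "f \<in> lsc_proper_convex" "\<forall>t\<in>T. g t \<in> lsc_proper_convex"
      and feasible: "feasible_set T g \<inter> domain f \<noteq> {}"
  proof -
    have eq: "closure (convex hull ?A) = epigraph (conjugate ?h)"
      using lsc feasible assms(6-8) by (intro closure_hull_A_set) auto
    obtain x1 where x1: "x1 \<in> feasible_set T g" "f x1 < \<infinity>"
      using feasible by (auto simp: domain_def)
    have bot: "conjugate ?h \<phi> \<noteq> - \<infinity>" for \<phi>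
    proof -
      have "ereal (dual_apply \<phi> x1) - ?h x1 \<le> conjugate ?h \<phi>"
        unfolding conjugate_def by (rule SUP_upper) simp
      moreover have "ereal (dual_apply \<phi> x1) - ?h x1 \<noteq> - \<infinity>"
        using x1 by (cases "f x1") (auto simp: indicator_fun_def)
      ultimately show ?thesis by auto
    qed
    have iff: "strong_duality_at T f g \<H> \<phi> \<longleftrightarrow> closed_convex_regarding ?A ({\<phi>} \<times> UNIV)" for \<phi>
    proof
      assume "closed_convex_regarding ?A ({\<phi>} \<times> UNIV)"
      then have "epigraph (conjugate ?h) \<inter> ({\<phi>} \<times> UNIV) \<subseteq> ?A"
        unfolding closed_convex_regarding_def eq by blast
      then show "strong_duality_at T f g \<H> \<phi>"
        by (rule strong_duality_if_attained[OF assms(8,6) bot])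
    qed (rule forward)
    \<comment> \<open>The fibres \<open>{\<phi>} \<times> UNIV\<close> cover the product, so equality on each of them is equality.\<close>
    have "stable_strong_duality T f g \<H> \<longleftrightarrow> closure (convex hull ?A) = ?A"
      unfolding stable_strong_duality_def iff closed_convex_regarding_def set_eq_iff by auto
    also have "\<dots> \<longleftrightarrow> closed ?A \<and> convex ?A"
    proof
      assume "closure (convex hull ?A) = ?A"
      then have "?A = epigraph (conjugate ?h)" using eq by simp
      then show "closed ?A \<and> convex ?A"
        using closed_epigraph_conjugate[of ?h] convex_epigraph_conjugate[of ?h] by simp
    next
      assume "closed ?A \<and> convex ?A"
      then show "closure (convex hull ?A) = ?A" by (simp add: hull_same)
    qed
    finally show ?thesis using iff by blast
  qed
  show ?thesis using forward lsc_case by blast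
qed

end
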